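(* Let $T$ be a contraction acting on a Hilbert space $\mathcal{H}$. Let $U_1$ and $U_2$ be any two unitary operators on $\mathcal{H}$, and let $(Y_{-n})_{n\in \mathbb{N}}$ and $(X_n)_{n\in \mathbb{N}}$ be any two sequences of unitary operators on $\mathcal{H}$ ($\mathbb{N}=\{1,2,\dots\}$). Define the operator $\mathbb{U}_T$ on $\mathcal{K}=\bigoplus_{n\in\mathbb{Z}} \mathcal{H}$ by $\mathbb{U}_T(h_i)_{i\in\mathbb{Z}}=(h_i')_{i\in\mathbb{Z}}$, where $$h'_i=\begin{cases} Y_{i+1}h_{i+1}, & i\leq -2,\\ U_2D_Th_0-U_2T^*U_1h_1, & i=-1,\\ Th_0+D_{T^*}U_1h_1, & i=0,\\ X_ih_{i+1}, & i\geq 1.\end{cases}$$ Then $\mathbb{U}_T$ is a unitary dilation of $T$, where $\mathcal{H}$ is identified with the zeroth summand of $\mathcal{K}$.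
   Context: All Hilbert spaces are complex and separable, and all operators are bounded and linear; a contraction is an operator of norm at most $1$. $D_T=(I-T^*T)^{1/2}$ and $D_{T^*}=(I-TT^* )^{1/2}$. The direct sum $\mathcal{K}$ is the $\ell^2$-direct sum. A unitary operator $U$ on a Hilbert space $\mathcal{K}\supseteq\mathcal{H}$ is a unitary dilation of $T\in\mathcal{B}(\mathcal{H})$ if $T^n=P_{\mathcal{H}}U^n|_{\mathcal{H}}$ for every integer $n\ge 0$, where $P_{\mathcal{H}}:\mathcal{K}\to\mathcal{H}$ is the orthogonal projection. *)

theory Defs
  imports "HOL-Analysis.Analysis"
begin

section \<open>Separable complex Hilbert spaces\<close>

class complex_vector = real_vector +
  fixes scaleC :: "complex \<Rightarrow> 'a \<Rightarrow> 'a"  (infixr \<open>*\<^sub>C\<close> 75)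
  assumes scaleC_add_right: "c *\<^sub>C (x + y) = c *\<^sub>C x + c *\<^sub>C y"
    and scaleC_add_left: "(c + d) *\<^sub>C x = c *\<^sub>C x + d *\<^sub>C x"
    and scaleC_scaleC: "c *\<^sub>C (d *\<^sub>C x) = (c * d) *\<^sub>C x"
    and scaleR_scaleC: "scaleR r x = complex_of_real r *\<^sub>C x"

text \<open>The inner product is linear in its first argument. Positive definiteness is contained in
  \<open>cinner_self\<close>, because the norm of a normed space is nonnegative and vanishes only at 0.\<close>

class complex_inner = complex_vector + real_normed_vector +
  fixes cinner :: "'a \<Rightarrow> 'a \<Rightarrow> complex"
  assumes cinner_commute: "cinner x y = cnj (cinner y x)"
    and cinner_add_left: "cinner (x + y) z = cinner x z + cinner y z"
    and cinner_scaleC_left: "cinner (c *\<^sub>C x) y = c * cinner x y"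
    and cinner_self: "cinner x x = complex_of_real ((norm x)\<^sup>2)"

class chilbert_space = complex_inner + complete_space +
  assumes separable: "\<exists>D. countable D \<and> (\<forall>x. \<forall>e>0. \<exists>d\<in>D. dist d x < e)"

lemma cinner_add_right: "cinner x (y + z) = cinner x y + cinner x (z :: 'a::complex_inner)"
  by (metis cinner_commute cinner_add_left complex_cnj_add)

lemma cinner_scaleC_right: "cinner x (c *\<^sub>C y) = cnj c * cinner x (y :: 'a::complex_inner)"
  by (metis cinner_commute cinner_scaleC_left complex_cnj_mult)

lemma norm_scaleC: "norm (c *\<^sub>C x) = cmod c * norm (x :: 'a::complex_inner)"
proof -
  have "complex_of_real ((norm (c *\<^sub>C x))\<^sup>2) = c * cnj c * complex_of_real ((norm x)\<^sup>2)"
    by (simp only: cinner_self[symmetric] cinner_scaleC_left cinner_scaleC_right mult_ac)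
  also have "\<dots> = complex_of_real ((cmod c * norm x)\<^sup>2)"
    by (simp add: complex_norm_square[symmetric] power_mult_distrib)
  finally have "(norm (c *\<^sub>C x))\<^sup>2 = (cmod c * norm x)\<^sup>2"
    using of_real_eq_iff by blast
  then show ?thesis by (simp add: power2_eq_iff_nonneg)
qed

lemma norm_add_sq:
  "(norm (x + y :: 'a::complex_inner))\<^sup>2 = (norm x)\<^sup>2 + (norm y)\<^sup>2 + 2 * Re (cinner x y)"
proof -
  have "(norm (x + y))\<^sup>2 = Re (cinner (x + y) (x + y))"
    by (simp add: cinner_self)
  also have "\<dots> = Re (cinner x x) + Re (cinner y y) + Re (cinner x y) + Re (cinner y x)"
    by (simp add: cinner_add_left cinner_add_right)
  also have "Re (cinner y x) = Re (cinner x y)"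
    by (metis cinner_commute cnj.simps(1))
  finally show ?thesis by (simp add: cinner_self)
qed

lemma Re_cinner_bound:
  "2 * \<bar>Re (cinner x (y :: 'a::complex_inner))\<bar> \<le> (norm x)\<^sup>2 + (norm y)\<^sup>2"
proof -
  have "cinner x ((-1) *\<^sub>C y) = - cinner x y"
    by (simp add: cinner_scaleC_right)
  moreover have "norm ((-1) *\<^sub>C y) = norm y"
    by (simp add: norm_scaleC)
  ultimately have "(norm (x + (-1) *\<^sub>C y))\<^sup>2 = (norm x)\<^sup>2 + (norm y)\<^sup>2 - 2 * Re (cinner x y)"
    using norm_add_sq[of x "(-1) *\<^sub>C y"] by simp
  moreover have "0 \<le> (norm (x + (-1) *\<^sub>C y))\<^sup>2" "0 \<le> (norm (x + y))\<^sup>2" by simp_all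
  ultimately show ?thesis using norm_add_sq[of x y] by linarith
qed

lemma cinner_bound:
  "cmod (cinner x (y :: 'a::complex_inner)) \<le> (norm x)\<^sup>2 + (norm y)\<^sup>2"
proof -
  have "cinner x (\<i> *\<^sub>C y) = - \<i> * cinner x y"
    by (simp add: cinner_scaleC_right)
  then have "2 * \<bar>Im (cinner x y)\<bar> \<le> (norm x)\<^sup>2 + (norm y)\<^sup>2"
    using Re_cinner_bound[of x "\<i> *\<^sub>C y"] by (simp add: norm_scaleC)
  with Re_cinner_bound[of x y] cmod_le[of "cinner x y"] show ?thesis by linarith
qed

section \<open>Operators\<close>

definition bounded_clinear :: "('a::complex_inner \<Rightarrow> 'b::complex_inner) \<Rightarrow> bool" where
  "bounded_clinear A \<longleftrightarrow> bounded_linear A \<and> (\<forall>c x. A (c *\<^sub>C x) = c *\<^sub>C A x)"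

definition contraction :: "('a::chilbert_space \<Rightarrow> 'a) \<Rightarrow> bool" where
  "contraction T \<longleftrightarrow> bounded_clinear T \<and> onorm T \<le> 1"

definition cadjoint :: "('a::chilbert_space \<Rightarrow> 'a) \<Rightarrow> 'a \<Rightarrow> 'a" where
  "cadjoint A = (THE B. bounded_clinear B \<and> (\<forall>x y. cinner (A x) y = cinner x (B y)))"

definition unitary :: "('a::chilbert_space \<Rightarrow> 'a) \<Rightarrow> bool" where
  "unitary U \<longleftrightarrow> bounded_clinear U \<and> cadjoint U \<circ> U = id \<and> U \<circ> cadjoint U = id"

definition positive_op :: "('a::chilbert_space \<Rightarrow> 'a) \<Rightarrow> bool" where
  "positive_op A \<longleftrightarrow> bounded_clinear A \<and> (\<forall>x. cinner (A x) x \<in> \<real>\<^sub>\<ge>\<^sub>0)"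

text \<open>The positive square root of a positive operator.\<close>

definition op_sqrt :: "('a::chilbert_space \<Rightarrow> 'a) \<Rightarrow> 'a \<Rightarrow> 'a" where
  "op_sqrt A = (THE B. positive_op B \<and> B \<circ> B = A)"

definition defect :: "('a::chilbert_space \<Rightarrow> 'a) \<Rightarrow> 'a \<Rightarrow> 'a" where
  "defect T = op_sqrt (\<lambda>x. x - cadjoint T (T x))"

definition defect_adj :: "('a::chilbert_space \<Rightarrow> 'a) \<Rightarrow> 'a \<Rightarrow> 'a" where
  "defect_adj T = op_sqrt (\<lambda>x. x - T (cadjoint T x))"

definition orth_proj :: "'a::chilbert_space set \<Rightarrow> 'a \<Rightarrow> 'a" where
  "orth_proj M x = (THE y. y \<in> M \<and> (\<forall>z\<in>M. cinner (x - y) z = 0))"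

definition isometric_embedding :: "('a::chilbert_space \<Rightarrow> 'b::chilbert_space) \<Rightarrow> bool" where
  "isometric_embedding V \<longleftrightarrow> bounded_clinear V \<and> (\<forall>x. norm (V x) = norm x)"

text \<open>The inclusion of \<open>H\<close> in \<open>K\<close> is rendered by an isometric embedding \<open>V\<close> of \<open>H\<close> into \<open>K\<close>,
  which identifies \<open>H\<close> with the closed subspace \<open>range V\<close>.\<close>

definition unitary_dilation ::
  "('a::chilbert_space \<Rightarrow> 'b::chilbert_space) \<Rightarrow> ('b \<Rightarrow> 'b) \<Rightarrow> ('a \<Rightarrow> 'a) \<Rightarrow> bool" where
  "unitary_dilation V U T \<longleftrightarrow>
     isometric_embedding V \<and> unitary U \<and> bounded_clinear T \<and>
     (\<forall>n h. V ((T ^^ n) h) = orth_proj (range V) ((U ^^ n) (V h)))"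

section \<open>The \<open>\<ell>\<^sup>2\<close>-direct sum of copies of a Hilbert space indexed by the integers\<close>

definition sqsum :: "(int \<Rightarrow> 'a::real_normed_vector) \<Rightarrow> bool" where
  "sqsum f \<longleftrightarrow> (\<lambda>i. (norm (f i))\<^sup>2) summable_on UNIV"

lemma sqsum_add_aux:
  assumes "sqsum f" "sqsum g"
  shows "sqsum (\<lambda>i. f i + g i)"
    and "(\<Sum>\<^sub>\<infinity>i. (norm (f i + g i))\<^sup>2)
          \<le> (sqrt (\<Sum>\<^sub>\<infinity>i. (norm (f i))\<^sup>2) + sqrt (\<Sum>\<^sub>\<infinity>i. (norm (g i))\<^sup>2))\<^sup>2" (is "_ \<le> ?b")
proof -
  have *: "(\<Sum>i\<in>F. (norm (f i + g i))\<^sup>2) \<le> ?b" if "finite F" for F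
  proof -
    have "L2_set (\<lambda>i. norm (f i + g i)) F \<le> L2_set (\<lambda>i. norm (f i) + norm (g i)) F"
      by (rule L2_set_mono) (auto simp: norm_triangle_ineq)
    also have "\<dots> \<le> L2_set (\<lambda>i. norm (f i)) F + L2_set (\<lambda>i. norm (g i)) F"
      by (rule L2_set_triangle_ineq)
    also have "\<dots> \<le> sqrt (\<Sum>\<^sub>\<infinity>i. (norm (f i))\<^sup>2) + sqrt (\<Sum>\<^sub>\<infinity>i. (norm (g i))\<^sup>2)"
      unfolding L2_set_def using assms that unfolding sqsum_def
      by (intro add_mono real_sqrt_le_mono finite_sum_le_infsum) auto
    finally have "(L2_set (\<lambda>i. norm (f i + g i)) F)\<^sup>2 \<le> ?b"
      by (intro power_mono) (auto simp: L2_set_nonneg)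
    then show ?thesis by (simp add: L2_set_def sum_nonneg)
  qed
  then show **: "sqsum (\<lambda>i. f i + g i)"
    unfolding sqsum_def by (intro nonneg_bdd_above_summable_on bdd_aboveI2[where M = ?b]) auto
  show "(\<Sum>\<^sub>\<infinity>i. (norm (f i + g i))\<^sup>2) \<le> ?b"
    using ** * unfolding sqsum_def by (intro infsum_le_finite_sums) auto
qed

lemma sqsum_scaleC: "sqsum f \<Longrightarrow> sqsum (\<lambda>i. c *\<^sub>C (f i :: 'a::complex_inner))"
  unfolding sqsum_def norm_scaleC power_mult_distrib by (rule summable_on_cmult_right)

lemma sqsum_finite: "finite F \<Longrightarrow> sqsum (\<lambda>i. if i \<in> F then f i else 0)"
  unfolding sqsum_def
  by (rule finite_nonzero_values_imp_summable_on) (rule finite_subset[of _ F], auto split: if_splits)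

typedef (overloaded) ('a::chilbert_space) zsum = "{f :: int \<Rightarrow> 'a. sqsum f}"
  morphisms coord Abs_zsum
  by (rule exI[of _ "\<lambda>_. 0"]) (simp add: sqsum_def)

setup_lifting type_definition_zsum

lemma sqsum_coord: "sqsum (coord x)"
  using coord[of x] by simp

lemma zsum_eqI: "(\<And>i. coord x i = coord y i) \<Longrightarrow> x = y"
  by (metis coord_inject ext)

instantiation zsum :: (chilbert_space) complex_vector
begin
lift_definition zero_zsum :: "'a zsum" is "\<lambda>_. 0"
  by (simp add: sqsum_def)
lift_definition plus_zsum :: "'a zsum \<Rightarrow> 'a zsum \<Rightarrow> 'a zsum" is "\<lambda>f g i. f i + g i"
  by (rule sqsum_add_aux)
lift_definition uminus_zsum :: "'a zsum \<Rightarrow> 'a zsum" is "\<lambda>f i. - f i"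
  by (simp add: sqsum_def)
definition minus_zsum :: "'a zsum \<Rightarrow> 'a zsum \<Rightarrow> 'a zsum" where "minus_zsum x y = x + - y"
lift_definition scaleC_zsum :: "complex \<Rightarrow> 'a zsum \<Rightarrow> 'a zsum" is "\<lambda>c f i. c *\<^sub>C f i"
  by (rule sqsum_scaleC)
definition scaleR_zsum :: "real \<Rightarrow> 'a zsum \<Rightarrow> 'a zsum" where
  "scaleR_zsum r x = complex_of_real r *\<^sub>C x"
instance
proof
  have one: "1 *\<^sub>C v = v" for v :: 'a
    by (metis of_real_1 scaleR_one scaleR_scaleC)
  fix a b c :: "'a zsum" and r s :: real and z w :: complex
  show "a + b + c = a + (b + c)" by transfer (simp add: add.assoc)
  show "a + b = b + a" by transfer (simp add: add.commute)
  show "0 + a = a" by transfer simp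
  show "- a + a = 0" by transfer simp
  show "a - b = a + - b" by (simp add: minus_zsum_def)
  show "z *\<^sub>C (a + b) = z *\<^sub>C a + z *\<^sub>C b" by transfer (simp add: scaleC_add_right)
  show "(z + w) *\<^sub>C a = z *\<^sub>C a + w *\<^sub>C a" by transfer (simp add: scaleC_add_left)
  show "z *\<^sub>C w *\<^sub>C a = (z * w) *\<^sub>C a" by transfer (simp add: scaleC_scaleC)
  show "r *\<^sub>R a = complex_of_real r *\<^sub>C a" by (rule scaleR_zsum_def)
  show "r *\<^sub>R (a + b) = r *\<^sub>R a + r *\<^sub>R b"
    unfolding scaleR_zsum_def by transfer (simp add: scaleC_add_right)
  show "(r + s) *\<^sub>R a = r *\<^sub>R a + s *\<^sub>R a"
    unfolding scaleR_zsum_def by transfer (simp add: scaleC_add_left)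
  show "r *\<^sub>R s *\<^sub>R a = (r * s) *\<^sub>R a"
    unfolding scaleR_zsum_def by transfer (simp add: scaleC_scaleC)
  show "1 *\<^sub>R a = a"
    unfolding scaleR_zsum_def by transfer (simp add: one)
qed
end

lemma coord_minus: "coord (x - y) i = coord x i - coord y i"
  unfolding minus_zsum_def plus_zsum.rep_eq uminus_zsum.rep_eq by simp

instantiation zsum :: (chilbert_space) complex_inner
begin
definition norm_zsum :: "'a zsum \<Rightarrow> real" where
  "norm_zsum x = sqrt (\<Sum>\<^sub>\<infinity>i. (norm (coord x i))\<^sup>2)"
definition cinner_zsum :: "'a zsum \<Rightarrow> 'a zsum \<Rightarrow> complex" where
  "cinner_zsum x y = (\<Sum>\<^sub>\<infinity>i. cinner (coord x i) (coord y i))"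
definition dist_zsum :: "'a zsum \<Rightarrow> 'a zsum \<Rightarrow> real" where
  "dist_zsum x y = norm (x - y)"
definition sgn_zsum :: "'a zsum \<Rightarrow> 'a zsum" where
  "sgn_zsum x = x /\<^sub>R norm x"
definition uniformity_zsum :: "('a zsum \<times> 'a zsum) filter" where
  "uniformity_zsum = (INF e\<in>{0<..}. principal {(x, y). dist x y < e})"
definition open_zsum :: "'a zsum set \<Rightarrow> bool" where
  "open_zsum S = (\<forall>x\<in>S. \<forall>\<^sub>F (x', y) in uniformity. x' = x \<longrightarrow> y \<in> S)"

lemma cinner_coord_summable:
  fixes x y :: "'a zsum"
  shows "(\<lambda>i. cinner (coord x i) (coord y i)) summable_on UNIV"
proof (rule Infinite_Sum.abs_summable_summable,
    rule Infinite_Sum.abs_summable_on_comparison_test')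
  show "(\<lambda>i. (norm (coord x i))\<^sup>2 + (norm (coord y i))\<^sup>2) summable_on UNIV"
    using sqsum_coord[of x] sqsum_coord[of y] unfolding sqsum_def by (rule summable_on_add)
qed (rule cinner_bound)

instance
proof
  fix x y z :: "'a zsum" and r :: real and c :: complex
  have sx: "(\<lambda>i. (norm (coord u i))\<^sup>2) summable_on UNIV" for u :: "'a zsum"
    using sqsum_coord unfolding sqsum_def .
  have nn: "0 \<le> (\<Sum>\<^sub>\<infinity>i. (norm (coord u i))\<^sup>2)" for u :: "'a zsum"
    by (rule infsum_nonneg) simp
  show "dist x y = norm (x - y)" by (rule dist_zsum_def)
  show "sgn x = x /\<^sub>R norm x" by (rule sgn_zsum_def)
  show "uniformity = (INF e\<in>{0<..}. principal {(x, y :: 'a zsum). dist x y < e})"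
    by (rule uniformity_zsum_def)
  show "open U = (\<forall>x\<in>U. \<forall>\<^sub>F (x', y) in uniformity. x' = x \<longrightarrow> y \<in> U)" for U :: "'a zsum set"
    by (rule open_zsum_def)
  show "(norm x = 0) = (x = 0)"
  proof
    assume "norm x = 0"
    then have "(norm (coord x i))\<^sup>2 = 0" for i
      using sx by (intro nonneg_infsum_le_0D[where A = UNIV]) (auto simp: norm_zsum_def)
    then show "x = 0" by (intro zsum_eqI) (simp add: zero_zsum.rep_eq)
  qed (simp add: norm_zsum_def zero_zsum.rep_eq)
  show "norm (x + y) \<le> norm x + norm y"
    unfolding norm_zsum_def plus_zsum.rep_eq
    by (rule real_le_lsqrt) (auto intro: sqsum_add_aux sqsum_coord simp: nn)
  show "norm (r *\<^sub>R x) = \<bar>r\<bar> * norm x"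
    by (simp add: norm_zsum_def scaleR_zsum_def scaleC_zsum.rep_eq norm_scaleC power_mult_distrib
        infsum_cmult_right' real_sqrt_mult)
  show "cinner x y = cnj (cinner y x)"
    unfolding cinner_zsum_def infsum_cnj[symmetric] by (rule infsum_cong, rule cinner_commute)
  show "cinner (x + y) z = cinner x z + cinner y z"
    unfolding cinner_zsum_def plus_zsum.rep_eq cinner_add_left
    by (rule infsum_add; rule cinner_coord_summable)
  show "cinner (c *\<^sub>C x) y = c * cinner x y"
    unfolding cinner_zsum_def scaleC_zsum.rep_eq cinner_scaleC_left by (rule infsum_cmult_right')
  have "((\<lambda>i. complex_of_real ((norm (coord x i))\<^sup>2)) has_sum
          complex_of_real (\<Sum>\<^sub>\<infinity>i. (norm (coord x i))\<^sup>2)) UNIV"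
    using sx by (intro has_sum_of_real has_sum_infsum)
  then show "cinner x x = complex_of_real ((norm x)\<^sup>2)"
    unfolding cinner_zsum_def norm_zsum_def cinner_self using nn by (simp add: infsumI)
qed
end

lemma norm_zsum_sq: "(norm x)\<^sup>2 = (\<Sum>\<^sub>\<infinity>i. (norm (coord x i))\<^sup>2)"
  by (simp add: norm_zsum_def infsum_nonneg)

lemma finite_sum_le_norm_zsum:
  "finite F \<Longrightarrow> (\<Sum>i\<in>F. (norm (coord x i))\<^sup>2) \<le> (norm x)\<^sup>2"
  unfolding norm_zsum_sq using sqsum_coord[of x] unfolding sqsum_def
  by (intro finite_sum_le_infsum) auto

lemma norm_coord_le: "norm (coord x i) \<le> norm x"
  using finite_sum_le_norm_zsum[of "{i}" x] by (simp add: power2_le_iff_abs_le)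

lemma norm_zsum_leI:
  assumes "\<And>F. finite F \<Longrightarrow> (\<Sum>i\<in>F. (norm (coord x i))\<^sup>2) \<le> b\<^sup>2" "0 \<le> b"
  shows "norm x \<le> b"
proof -
  have "(norm x)\<^sup>2 \<le> b\<^sup>2"
    unfolding norm_zsum_sq using sqsum_coord[of x] assms(1) unfolding sqsum_def
    by (intro infsum_le_finite_sums) auto
  then show ?thesis using assms(2) by (rule power2_le_imp_le)
qed

lemma zsum_Cauchy_convergent:
  assumes "Cauchy (X :: nat \<Rightarrow> 'a::chilbert_space zsum)"
  shows "convergent X"
proof -
  have "Cauchy (\<lambda>n. coord (X n) i)" for i
    unfolding Cauchy_def
  proof (intro allI impI)
    fix e :: real assume "e > 0"
    then obtain M where "\<forall>m\<ge>M. \<forall>n\<ge>M. dist (X m) (X n) < e"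
      using assms unfolding Cauchy_def by blast
    then show "\<exists>M. \<forall>m\<ge>M. \<forall>n\<ge>M. dist (coord (X m) i) (coord (X n) i) < e"
      by (metis dist_norm coord_minus norm_coord_le le_less_trans)
  qed
  then have "\<exists>l. (\<lambda>n. coord (X n) i) \<longlonglongrightarrow> l" for i
    using Cauchy_convergent convergent_def by blast
  then obtain f where f: "\<And>i. (\<lambda>n. coord (X n) i) \<longlonglongrightarrow> f i" by metis
  have bound: "(\<Sum>i\<in>F. (norm (coord (X n) i - f i))\<^sup>2) \<le> e\<^sup>2"
    if M: "\<forall>m\<ge>M. \<forall>n\<ge>M. dist (X m) (X n) < e" and n: "n \<ge> M" and F: "finite F" for e M n F
  proof (rule tendsto_upperbound)
    show "(\<lambda>m. \<Sum>i\<in>F. (norm (coord (X n) i - coord (X m) i))\<^sup>2)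
            \<longlonglongrightarrow> (\<Sum>i\<in>F. (norm (coord (X n) i - f i))\<^sup>2)"
      by (intro tendsto_intros f)
    have "(\<Sum>i\<in>F. (norm (coord (X n) i - coord (X m) i))\<^sup>2) \<le> e\<^sup>2" if "m \<ge> M" for m
    proof -
      have "(\<Sum>i\<in>F. (norm (coord (X n) i - coord (X m) i))\<^sup>2) \<le> (norm (X n - X m))\<^sup>2"
        using finite_sum_le_norm_zsum[OF F, of "X n - X m"] by (simp add: coord_minus)
      also have "\<dots> \<le> e\<^sup>2"
        using M n that by (intro power_mono) (auto simp: dist_norm intro: less_imp_le)
      finally show ?thesis .
    qed
    then show "\<forall>\<^sub>F m in sequentially. (\<Sum>i\<in>F. (norm (coord (X n) i - coord (X m) i))\<^sup>2) \<le> e\<^sup>2"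
      using eventually_sequentially by blast
  qed simp
  obtain M where M: "\<forall>m\<ge>M. \<forall>n\<ge>M. dist (X m) (X n) < 1"
    using assms unfolding Cauchy_def by (meson zero_less_one)
  have "sqsum (\<lambda>i. coord (X M) i - f i)"
    unfolding sqsum_def using bound[OF M order_refl]
    by (intro nonneg_bdd_above_summable_on bdd_aboveI2[where M = "1\<^sup>2"]) auto
  then have "sqsum (\<lambda>i. - (coord (X M) i - f i))"
    unfolding sqsum_def norm_minus_cancel .
  from sqsum_add_aux(1)[OF sqsum_coord[of "X M"] this] have sf: "sqsum f" by simp
  define L where "L = Abs_zsum f"
  have L: "coord L = f" unfolding L_def using sf by (simp add: Abs_zsum_inverse)
  have "X \<longlonglongrightarrow> L"
  proof (rule metric_LIMSEQ_I)
    fix r :: real assume r: "r > 0"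
    then obtain M where M: "\<forall>m\<ge>M. \<forall>n\<ge>M. dist (X m) (X n) < r / 2"
      using assms unfolding Cauchy_def by (meson half_gt_zero)
    have "dist (X n) L < r" if "n \<ge> M" for n
    proof -
      have "norm (X n - L) \<le> r / 2"
        using bound[OF M that] r by (intro norm_zsum_leI) (auto simp: coord_minus L)
      then show ?thesis using r by (simp add: dist_norm)
    qed
    then show "\<exists>no. \<forall>n\<ge>no. dist (X n) L < r" by blast
  qed
  then show ?thesis by (rule convergentI)
qed

lemma zsum_separable:
  "\<exists>E :: 'a::chilbert_space zsum set. countable E \<and> (\<forall>x. \<forall>e>0. \<exists>y\<in>E. dist y x < e)"
proof -
  obtain D :: "'a set" where D: "countable D" "\<And>x e. e > 0 \<Longrightarrow> \<exists>d\<in>D. dist d x < e"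
    using separable[where 'a = 'a] by blast
  define g :: "(int \<times> 'a) list \<Rightarrow> int \<Rightarrow> 'a" where
    "g l i = (case map_of l i of None \<Rightarrow> 0 | Some v \<Rightarrow> v)" for l i
  define E where "E = Abs_zsum ` g ` lists (UNIV \<times> D)"
  have "countable E"
    unfolding E_def using D(1) by (intro countable_image countable_lists) auto
  moreover have "\<exists>y\<in>E. dist y x < e" if e: "e > 0" for x e
  proof -
    obtain F where F: "finite F"
      and tail: "(\<Sum>\<^sub>\<infinity>i. (norm (coord x i))\<^sup>2) - (\<Sum>i\<in>F. (norm (coord x i))\<^sup>2) < (e/2)\<^sup>2"
    proof -
      have "(sum (\<lambda>i. (norm (coord x i))\<^sup>2) \<longlongrightarrow> (\<Sum>\<^sub>\<infinity>i. (norm (coord x i))\<^sup>2))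
              (finite_subsets_at_top UNIV)"
        using has_sum_infsum[OF sqsum_coord[of x, unfolded sqsum_def]] unfolding has_sum_def .
      then have "\<forall>\<^sub>F F in finite_subsets_at_top UNIV.
          dist (\<Sum>i\<in>F. (norm (coord x i))\<^sup>2) (\<Sum>\<^sub>\<infinity>i. (norm (coord x i))\<^sup>2) < (e/2)\<^sup>2"
        using e by (intro tendstoD) auto
      then obtain F where "finite F"
          "dist (\<Sum>i\<in>F. (norm (coord x i))\<^sup>2) (\<Sum>\<^sub>\<infinity>i. (norm (coord x i))\<^sup>2) < (e/2)\<^sup>2"
        unfolding eventually_finite_subsets_at_top by auto
      then show thesis by (intro that[of F]) (auto simp: dist_real_def)
    qed
    define d where "d = (e/2)\<^sup>2 - ((norm x)\<^sup>2 - (\<Sum>i\<in>F. (norm (coord x i))\<^sup>2))"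
    have d: "d > 0" using tail by (simp add: d_def norm_zsum_sq)
    define \<delta> where "\<delta> = sqrt (d / (card F + 1))"
    have \<delta>: "\<delta> > 0" "\<delta>\<^sup>2 = d / (card F + 1)" using d by (auto simp: \<delta>_def)
    have "\<forall>i. \<exists>v\<in>D. dist v (coord x i) < \<delta>"
      using D(2) \<delta>(1) by blast
    then obtain v where v: "\<And>i. v i \<in> D" "\<And>i. dist (v i) (coord x i) < \<delta>" by metis
    define h where "h = (\<lambda>i. if i \<in> F then v i else 0)"
    define y where "y = Abs_zsum h"
    have y: "coord y = h"
      unfolding y_def h_def by (rule Abs_zsum_inverse) (simp add: sqsum_finite[OF F])
    obtain l where l: "set l = F" using finite_list[OF F] by blast
    have "h = g (map (\<lambda>i. (i, v i)) l)"
      unfolding h_def g_def using l by (auto simp: map_of_map_restrict fun_eq_iff)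
    moreover have "map (\<lambda>i. (i, v i)) l \<in> lists (UNIV \<times> D)" using v(1) by auto
    ultimately have "y \<in> E" unfolding E_def y_def by blast
    moreover have "norm (x - y) \<le> e / 2"
    proof (rule norm_zsum_leI)
      fix G :: "int set" assume G: "finite G"
      have "(\<Sum>i\<in>G. (norm (coord (x - y) i))\<^sup>2) \<le> (\<Sum>i\<in>G \<union> F. (norm (coord (x - y) i))\<^sup>2)"
        using G F by (intro sum_mono2) auto
      also have "\<dots> = (\<Sum>i\<in>F. (norm (coord (x - y) i))\<^sup>2) + (\<Sum>i\<in>G - F. (norm (coord (x - y) i))\<^sup>2)"
        using G F sum.union_disjoint[of F "G - F" "\<lambda>i. (norm (coord (x - y) i))\<^sup>2"]
        by (auto simp: Un_commute)
      also have "(\<Sum>i\<in>G - F. (norm (coord (x - y) i))\<^sup>2) = (\<Sum>i\<in>G - F. (norm (coord x i))\<^sup>2)"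
        by (rule sum.cong) (auto simp: coord_minus y h_def)
      also have "\<dots> \<le> (norm x)\<^sup>2 - (\<Sum>i\<in>F. (norm (coord x i))\<^sup>2)"
        using finite_sum_le_norm_zsum[of "F \<union> (G - F)" x] G F
          sum.union_disjoint[of F "G - F" "\<lambda>i. (norm (coord x i))\<^sup>2"] by auto
      also have "(\<Sum>i\<in>F. (norm (coord (x - y) i))\<^sup>2) \<le> (\<Sum>i\<in>F. \<delta>\<^sup>2)"
      proof (rule sum_mono)
        fix i assume "i \<in> F"
        then show "(norm (coord (x - y) i))\<^sup>2 \<le> \<delta>\<^sup>2"
          using v(2)[of i] by (intro power_mono) (auto simp: coord_minus y h_def dist_norm norm_minus_commute)
      qed
      also have "(\<Sum>i\<in>F. \<delta>\<^sup>2) \<le> d"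
        using d by (simp add: \<delta>(2) field_simps)
      finally show "(\<Sum>i\<in>G. (norm (coord (x - y) i))\<^sup>2) \<le> (e/2)\<^sup>2"
        by (simp add: d_def)
    qed (use e in simp)
    ultimately show ?thesis
      using e by (intro bexI[of _ y]) (auto simp: dist_norm norm_minus_commute)
  qed
  ultimately show ?thesis
    by blast
qed

instance zsum :: (chilbert_space) chilbert_space
  by standard (rule zsum_Cauchy_convergent, assumption, rule zsum_separable)

lift_definition zeroth :: "'a::chilbert_space \<Rightarrow> 'a zsum" is "\<lambda>h i. if i = 0 then h else 0"
  using sqsum_finite[of "{0}"] by simp

section \<open>The operator on the direct sum\<close>

text \<open>\<open>Y\<close> is used only at negative and \<open>X\<close> only at positive integers.\<close>

definition UT_coord :: "('a::chilbert_space \<Rightarrow> 'a) \<Rightarrow> ('a \<Rightarrow> 'a) \<Rightarrow> ('a \<Rightarrow> 'a) \<Rightarrow>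
    (int \<Rightarrow> 'a \<Rightarrow> 'a) \<Rightarrow> (int \<Rightarrow> 'a \<Rightarrow> 'a) \<Rightarrow> (int \<Rightarrow> 'a) \<Rightarrow> int \<Rightarrow> 'a" where
  "UT_coord T U1 U2 Y X h i =
     (if i \<le> -2 then Y (i + 1) (h (i + 1))
      else if i = -1 then U2 (defect T (h 0)) - U2 (cadjoint T (U1 (h 1)))
      else if i = 0 then T (h 0) + defect_adj T (U1 (h 1))
      else X i (h (i + 1)))"

text \<open>\<open>Abs_zsum\<close> is meaningful only on square-summable families; \<open>UT_coord\<close> yields such a family
  when \<open>T\<close> is a contraction and the other operators are unitary.\<close>

definition UT :: "('a::chilbert_space \<Rightarrow> 'a) \<Rightarrow> ('a \<Rightarrow> 'a) \<Rightarrow> ('a \<Rightarrow> 'a) \<Rightarrow>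
    (int \<Rightarrow> 'a \<Rightarrow> 'a) \<Rightarrow> (int \<Rightarrow> 'a \<Rightarrow> 'a) \<Rightarrow> 'a zsum \<Rightarrow> 'a zsum" where
  "UT T U1 U2 Y X k = Abs_zsum (UT_coord T U1 U2 Y X (coord k))"

end

theory Submission
  imports Defs
begin

text \<open>
  The operator is a bilateral weighted shift \<open>h'\<^sub>i = W\<^sub>i h\<^sub>i\<^sub>+\<^sub>1\<close> with unitary weights, except that the pair
  of entries \<open>(h\<^sub>0, h\<^sub>1)\<close> is sent to the pair of entries at \<open>-1\<close> and \<open>0\<close> by
  \<open>diag(U\<^sub>2, I) J diag(I, U\<^sub>1)\<close>, where \<open>J (a, b) = (D\<^sub>T a - T\<^sup>* b, T a + D\<^sub>T\<^sub>* b)\<close> is the Julia operator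
  of \<open>T\<close>. It is therefore unitary as soon as \<open>J\<close> is. Given \<open>D\<^sub>T\<^sup>2 = I - T\<^sup>*T\<close> and
  \<open>D\<^sub>T\<^sub>*\<^sup>2 = I - TT\<^sup>*\<close>, unitarity of \<open>J\<close> reduces to the intertwining relation \<open>T D\<^sub>T = D\<^sub>T\<^sub>* T\<close>
  (\<open>defect_intertwine\<close>): it cancels the cross terms in \<open>julia_isometry\<close>, and it makes the
  adjoint matrix an inverse in \<open>julia_surjective\<close>.

  The dilation property comes from triangularity. If all entries with positive index vanish, they
  still vanish after one application of the operator, and the entry at \<open>0\<close> is multiplied by \<open>T\<close>.
  So the powers applied to a vector of the zeroth summand have entry \<open>T\<^sup>n h\<close> at \<open>0\<close>
  (\<open>coord_U_power_zeroth\<close>).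

  Behind this stand two constructions on a Hilbert space. Adjoints come from the Riesz
  representation theorem, whose vector is found by minimising \<open>\<parallel>x\<parallel>\<^sup>2 - 2 Re (f x)\<close>. For a
  self-adjoint contraction \<open>C\<close>, the square root of \<open>I - C\<close> is \<open>I - lim q\<^sub>n(C)\<close>, where the \<open>q\<^sub>n\<close>
  are the polynomials obtained by iterating \<open>q \<mapsto> (X + q\<^sup>2) / 2\<close> from \<open>0\<close>. The differences of these
  polynomials have nonnegative coefficients, so the norm of \<open>q\<^sub>m(C) - q\<^sub>n(C)\<close> is at most the real
  number \<open>q\<^sub>m(1) - q\<^sub>n(1)\<close>, which tends to \<open>0\<close>. Being a limit of polynomials in \<open>C\<close>, the root inherits every
  intertwining relation of \<open>C\<close>. This gives both its uniqueness (\<open>op_sqrt_one_minus\<close>) and the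
  relation \<open>T D\<^sub>T = D\<^sub>T\<^sub>* T\<close>.
\<close>

section \<open>Inner products\<close>

instance chilbert_space \<subseteq> banach ..

lemma scaleC_zero_right [simp]: "c *\<^sub>C (0 :: 'a::complex_inner) = 0"
  using scaleC_add_right[of c "0 :: 'a" 0] by simp

lemma scaleC_diff_right: "c *\<^sub>C (x - y) = c *\<^sub>C x - c *\<^sub>C (y :: 'a::complex_inner)"
  using scaleC_add_right[of c "x - y" y] by (simp add: algebra_simps)

lemma minus_one_scaleC: "(-1) *\<^sub>C v = - (v :: 'a::complex_inner)"
  by (metis of_real_1 of_real_minus scaleR_minus1_left scaleR_scaleC)

lemma cinner_minus_left: "cinner (- x) y = - cinner (x :: 'a::complex_inner) y"
  using cinner_scaleC_left[of "-1" x y] by (simp add: minus_one_scaleC)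

lemma cinner_minus_right: "cinner x (- y) = - cinner (x :: 'a::complex_inner) y"
  using cinner_scaleC_right[of x "-1" y] by (simp add: minus_one_scaleC)

lemma cinner_diff_left: "cinner (x - y) z = cinner x z - cinner (y :: 'a::complex_inner) z"
  using cinner_add_left[of x "- y" z] by (simp add: cinner_minus_left)

lemma cinner_diff_right: "cinner z (x - y) = cinner z x - cinner z (y :: 'a::complex_inner)"
  using cinner_add_right[of z x "- y"] by (simp add: cinner_minus_right)

lemma cinner_scaleR_left: "cinner (r *\<^sub>R x) y = of_real r * cinner (x :: 'a::complex_inner) y"
  by (simp add: scaleR_scaleC cinner_scaleC_left)

lemma cinner_scaleR_right: "cinner x (r *\<^sub>R y) = of_real r * cinner (x :: 'a::complex_inner) y"
  by (simp add: scaleR_scaleC cinner_scaleC_right)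

lemma cinner_zero_left [simp]: "cinner 0 (x :: 'a::complex_inner) = 0"
  using cinner_scaleR_left[of 0 0 x] by simp

lemma cinner_zero_right [simp]: "cinner (x :: 'a::complex_inner) 0 = 0"
  using cinner_scaleR_right[of x 0 0] by simp

lemmas cinner_simps = cinner_add_left cinner_add_right cinner_diff_left cinner_diff_right
  cinner_minus_left cinner_minus_right cinner_scaleR_left cinner_scaleR_right

lemma Re_cinner_commute: "Re (cinner x y) = Re (cinner y (x :: 'a::complex_inner))"
  by (metis cinner_commute cnj.simps(1))

lemma norm_diff_sq:
  "(norm (x - y :: 'a::complex_inner))\<^sup>2 = (norm x)\<^sup>2 + (norm y)\<^sup>2 - 2 * Re (cinner x y)"
  using norm_add_sq[of x "- y"] by (simp add: cinner_minus_right)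

lemma Re_cinner_eqI:
  fixes a b :: "'a::complex_inner"
  assumes "\<And>x. Re (cinner x a) = Re (cinner x b)"
  shows "a = b"
proof -
  have "Re (cinner (a - b) (a - b)) = 0"
    using assms[of "a - b"] by (simp add: cinner_diff_right)
  then show ?thesis by (simp add: cinner_self)
qed

lemma cinner_eqI:
  fixes a b :: "'a::complex_inner"
  assumes "\<And>x. cinner x a = cinner x b"
  shows "a = b"
  by (rule Re_cinner_eqI) (simp add: assms)

text \<open>The Cauchy--Schwarz inequality for the real part: for unit vectors it is
  \<open>Re_cinner_bound\<close>, and both sides scale in the same way.\<close>

lemma Re_cinner_le_norm: "Re (cinner x y) \<le> norm x * norm (y :: 'a::complex_inner)"
proof (cases "x = 0 \<or> y = 0")
  case False
  define u where "u = x /\<^sub>R norm x"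
  define v where "v = y /\<^sub>R norm y"
  have "norm u = 1" "norm v = 1" using False by (simp_all add: u_def v_def)
  then have "Re (cinner u v) \<le> 1" using Re_cinner_bound[of u v] by simp
  moreover have "x = norm x *\<^sub>R u" "y = norm y *\<^sub>R v" using False by (simp_all add: u_def v_def)
  then have "cinner x y = of_real (norm x * norm y) * cinner u v"
    by (metis cinner_scaleR_left cinner_scaleR_right mult.assoc of_real_mult)
  then have "Re (cinner x y) = (norm x * norm y) * Re (cinner u v)" by simp
  ultimately show ?thesis by (simp add: mult_left_le)
qed auto

text \<open>The first-order condition at a minimum, in the form used for variational arguments.\<close>

lemma linear_coeff_zero_if_quadratic_nonneg:
  fixes a b :: real
  assumes "\<And>t. 0 \<le> t\<^sup>2 * a + 2 * t * b"
  shows "b = 0"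
proof (rule ccontr)
  assume b: "b \<noteq> 0"
  \<comment> \<open>At \<open>t = - b / s\<close> with \<open>s\<close> positive and at least \<open>a\<close>, the quadratic is at most \<open>- b\<^sup>2 / s\<close>.\<close>
  define s where "s = \<bar>a\<bar> + 1"
  have s: "s > 0" "a \<le> s" by (auto simp: s_def)
  have "0 \<le> (- b / s)\<^sup>2 * a + 2 * (- b / s) * b" by (rule assms)
  also have "\<dots> \<le> (- b / s)\<^sup>2 * s + 2 * (- b / s) * b"
    using s by (intro add_right_mono mult_left_mono) auto
  also have "\<dots> = - (b\<^sup>2 / s)" using s by (simp add: power2_eq_square field_simps)
  also have "\<dots> < 0" using b s by simp
  finally show False by simp
qed

section \<open>Adjoints\<close>

text \<open>The representing vector is the minimiser of \<open>J x = \<parallel>x\<parallel>\<^sup>2 - 2 Re (f x)\<close>: if \<open>f x = \<langle>x, z\<rangle>\<close>, then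
  \<open>J x = \<parallel>x - z\<parallel>\<^sup>2 - \<parallel>z\<parallel>\<^sup>2\<close>. By the parallelogram law a minimising sequence is Cauchy, and the
  first-order condition at its limit is the representation of the real part of \<open>f\<close>. The imaginary
  part follows by replacing \<open>x\<close> with \<open>\<i> x\<close>.\<close>

lemma riesz_representation:
  fixes f :: "'a::chilbert_space \<Rightarrow> complex"
  assumes add: "\<And>x y. f (x + y) = f x + f y"
    and scale: "\<And>c x. f (c *\<^sub>C x) = c * f x"
    and bound: "\<And>x. Re (f x) \<le> M * norm x"
  shows "\<exists>z. \<forall>x. f x = cinner x z"
proof -
  define J where "J x = (norm x)\<^sup>2 - 2 * Re (f x)" for x
  have scaleR: "f (r *\<^sub>R x) = of_real r * f x" for r x by (simp add: scaleR_scaleC scale)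
  have diff: "f (x - y) = f x - f y" for x y
    using add[of "x - y" y] by simp
  have J_ge: "J x \<ge> - M\<^sup>2" for x
  proof -
    have "0 \<le> (norm x - M)\<^sup>2" by simp
    then show ?thesis using bound[of x] by (simp add: J_def power2_diff mult.commute)
  qed
  define m where "m = Inf (range J)"
  have bdd: "bdd_below (range J)" using J_ge by (intro bdd_belowI2)
  have m_le: "m \<le> J x" for x unfolding m_def using bdd by (intro cInf_lower) auto
  have "\<exists>x. J x < m + 1 / real (Suc n)" for n
  proof -
    have "Inf (range J) < m + 1 / real (Suc n)" by (simp add: m_def)
    then show ?thesis using cInf_less_iff[OF _ bdd] by auto
  qed
  then obtain X where X: "\<And>n. J (X n) < m + 1 / real (Suc n)" by metis
  \<comment> \<open>Parallelogram law; the midpoint of \<open>x\<close> and \<open>y\<close> cannot beat the infimum \<open>m\<close>.\<close>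
  have par: "(norm (x - y))\<^sup>2 \<le> 2 * (J x - m) + 2 * (J y - m)" for x y
  proof -
    have "norm ((1/2) *\<^sub>R (x + y)) = norm (x + y) / 2" by (simp only: norm_scaleR)
    then have "4 * J ((1/2) *\<^sub>R (x + y)) = (norm (x + y))\<^sup>2 - 4 * Re (f x) - 4 * Re (f y)"
      unfolding J_def scaleR add by (simp add: power_divide add_divide_distrib del: scaleR_add_right)
    then have "(norm (x - y))\<^sup>2 = 2 * J x + 2 * J y - 4 * J ((1/2) *\<^sub>R (x + y))"
      by (simp add: J_def norm_add_sq norm_diff_sq)
    then show ?thesis using m_le[of "(1/2) *\<^sub>R (x + y)"] by simp
  qed
  have "Cauchy X"
  proof (rule CauchyI)
    fix e :: real assume e: "e > 0"
    then obtain N where N: "inverse (real (Suc N)) < e\<^sup>2 / 4"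
      using reals_Archimedean[of "e\<^sup>2 / 4"] by auto
    have small: "J (X n) - m < e\<^sup>2 / 4" if "n \<ge> N" for n
    proof -
      have "1 / real (Suc n) \<le> inverse (real (Suc N))"
        using that by (simp add: field_simps)
      then show ?thesis using X[of n] N by linarith
    qed
    have "norm (X i - X j) < e" if "i \<ge> N" "j \<ge> N" for i j
    proof -
      have "(norm (X i - X j))\<^sup>2 \<le> 2 * (J (X i) - m) + 2 * (J (X j) - m)" by (rule par)
      also have "\<dots> < 2 * (e\<^sup>2 / 4) + 2 * (e\<^sup>2 / 4)"
        by (intro add_strict_mono mult_strict_left_mono small that) simp_all
      also have "\<dots> = e\<^sup>2" by simp
      finally show ?thesis using e by (simp add: power2_less_imp_less)
    qed
    then show "\<exists>N. \<forall>i\<ge>N. \<forall>j\<ge>N. norm (X i - X j) < e" by blast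
  qed
  then obtain z where z: "X \<longlonglongrightarrow> z" using Cauchy_convergent convergent_def by blast
  have "bounded_linear (\<lambda>x. Re (f x))"
  proof (rule bounded_linear_intro[where K = M])
    fix x
    have "Re (f (- x)) = - Re (f x)" using scaleR[of "-1" x] by simp
    then show "norm (Re (f x)) \<le> norm x * M"
      using bound[of x] bound[of "- x"] by (simp add: mult.commute abs_le_iff)
  qed (simp_all add: add scaleR)
  from bounded_linear.tendsto[OF this z] have "(\<lambda>n. J (X n)) \<longlonglongrightarrow> J z"
    unfolding J_def by (intro tendsto_diff tendsto_mult tendsto_power tendsto_norm tendsto_const z)
  moreover have "(\<lambda>n. m + 1 / real (Suc n)) \<longlonglongrightarrow> m + 0"
    using LIMSEQ_inverse_real_of_nat by (intro tendsto_intros) (simp add: field_simps)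
  ultimately have "J z \<le> m + 0"
    using X by (intro LIMSEQ_le) (auto intro: less_imp_le)
  then have z_min: "J z \<le> J x" for x using m_le[of x] by simp
  have Re_eq: "Re (f v) = Re (cinner v z)" for v
  proof -
    have "0 \<le> t\<^sup>2 * (norm v)\<^sup>2 + 2 * t * (Re (cinner v z) - Re (f v))" for t
      using z_min[of "z + t *\<^sub>R v"] Re_cinner_commute[of z v]
      by (simp add: J_def norm_add_sq add scaleR cinner_simps power_mult_distrib algebra_simps)
    then show ?thesis using linear_coeff_zero_if_quadratic_nonneg by fastforce
  qed
  have "f v = cinner v z" for v
  proof (rule complex_eqI)
    show "Im (f v) = Im (cinner v z)"
      using Re_eq[of "\<i> *\<^sub>C v"] by (simp add: scale cinner_scaleC_left)
  qed (rule Re_eq)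
  then show ?thesis by blast
qed

lemma bounded_clinearI:
  fixes A :: "'a::complex_inner \<Rightarrow> 'b::complex_inner"
  assumes "\<And>x y. A (x + y) = A x + A y" "\<And>c x. A (c *\<^sub>C x) = c *\<^sub>C A x"
    and "\<And>x. norm (A x) \<le> K * norm x"
  shows "bounded_clinear A"
  unfolding bounded_clinear_def using assms
  by (auto intro!: bounded_linear_intro[where K = K] simp: scaleR_scaleC mult.commute)

lemma bounded_clinear_add: "bounded_clinear A \<Longrightarrow> A (x + y) = A x + A y"
  and bounded_clinear_diff: "bounded_clinear A \<Longrightarrow> A (x - y) = A x - A y"
  and bounded_clinear_minus: "bounded_clinear A \<Longrightarrow> A (- x) = - A x"
  and bounded_clinear_zero: "bounded_clinear A \<Longrightarrow> A 0 = 0"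
  and bounded_clinear_scaleR: "bounded_clinear A \<Longrightarrow> A (r *\<^sub>R x) = r *\<^sub>R A x"
  and bounded_clinear_scaleC: "bounded_clinear A \<Longrightarrow> A (c *\<^sub>C x) = c *\<^sub>C A x"
  unfolding bounded_clinear_def
  by (simp_all add: linear_simps)

lemmas clinear_simps = bounded_clinear_add bounded_clinear_diff bounded_clinear_minus
  bounded_clinear_zero bounded_clinear_scaleR bounded_clinear_scaleC

lemma bounded_clinear_bound:
  assumes "bounded_clinear A"
  obtains K where "K \<ge> 0" "\<And>x. norm (A x) \<le> K * norm x"
  using assms bounded_linear.nonneg_bounded unfolding bounded_clinear_def
  by (metis mult.commute)

lemma adjoint_exists:
  fixes A :: "'a::chilbert_space \<Rightarrow> 'a"
  assumes A: "bounded_clinear A"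
  shows "\<exists>B. bounded_clinear B \<and> (\<forall>x y. cinner (A x) y = cinner x (B y))"
proof -
  obtain K where K: "K \<ge> 0" "\<And>x. norm (A x) \<le> K * norm x"
    using bounded_clinear_bound[OF A] by blast
  have Re_le: "Re (cinner (A x) y) \<le> (K * norm y) * norm x" for x y
  proof -
    have "Re (cinner (A x) y) \<le> norm (A x) * norm y" by (rule Re_cinner_le_norm)
    also have "\<dots> \<le> (K * norm x) * norm y" by (intro mult_right_mono K) simp
    finally show ?thesis by (simp add: mult_ac)
  qed
  have "\<exists>z. \<forall>x. cinner (A x) y = cinner x z" for y
    by (rule riesz_representation[where M = "K * norm y"])
      (simp_all add: clinear_simps[OF A] cinner_add_left cinner_scaleC_left Re_le)
  then obtain B where B: "\<And>x y. cinner (A x) y = cinner x (B y)" by metis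
  have "bounded_clinear B"
  proof (rule bounded_clinearI)
    show "B (x + y) = B x + B y" for x y
      by (rule cinner_eqI) (simp add: B[symmetric] cinner_add_right)
    show "B (c *\<^sub>C x) = c *\<^sub>C B x" for c x
      by (rule cinner_eqI) (simp add: B[symmetric] cinner_scaleC_right)
    show "norm (B y) \<le> K * norm y" for y
    proof -
      have "(norm (B y))\<^sup>2 = Re (cinner (A (B y)) y)" by (simp add: B cinner_self)
      also have "\<dots> \<le> (K * norm y) * norm (B y)" by (rule Re_le)
      finally show ?thesis
        using K(1) by (cases "B y = 0") (auto simp: power2_eq_square)
    qed
  qed
  with B show ?thesis by blast
qed

lemma cadjoint_eqI:
  assumes "bounded_clinear B" "\<And>x y. cinner (A x) y = cinner x (B y)"
  shows "cadjoint A = B"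
  unfolding cadjoint_def
proof (rule the_equality)
  fix B' assume B': "bounded_clinear B' \<and> (\<forall>x y. cinner (A x) y = cinner x (B' y))"
  show "B' = B"
  proof
    show "B' y = B y" for y by (rule cinner_eqI) (metis assms(2) B')
  qed
qed (use assms in blast)

lemma bounded_clinear_cadjoint: "bounded_clinear A \<Longrightarrow> bounded_clinear (cadjoint A)"
  and cinner_cadjoint_right: "bounded_clinear A \<Longrightarrow> cinner x (cadjoint A y) = cinner (A x) y"
  using adjoint_exists[of A] cadjoint_eqI[of _ A] by metis+

lemma cinner_cadjoint_left: "bounded_clinear A \<Longrightarrow> cinner (cadjoint A x) y = cinner x (A y)"
  by (metis cinner_cadjoint_right cinner_commute)

lemma cadjoint_cadjoint: "bounded_clinear A \<Longrightarrow> cadjoint (cadjoint A) = A"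
  by (rule cadjoint_eqI) (simp_all add: cinner_cadjoint_left)

text \<open>From \<open>\<parallel>A\<^sup>* x\<parallel>\<^sup>2 = \<langle>A A\<^sup>* x, x\<rangle> \<le> \<parallel>A\<^sup>* x\<parallel> \<parallel>x\<parallel>\<close>.\<close>

lemma norm_cadjoint_le:
  assumes A: "bounded_clinear A" and le: "\<And>x. norm (A x) \<le> norm x"
  shows "norm (cadjoint A x) \<le> norm x"
proof -
  have "(norm (cadjoint A x))\<^sup>2 = Re (cinner (A (cadjoint A x)) x)"
    by (metis A cinner_cadjoint_right cinner_self Re_complex_of_real)
  also have "\<dots> \<le> norm (A (cadjoint A x)) * norm x" by (rule Re_cinner_le_norm)
  also have "\<dots> \<le> norm (cadjoint A x) * norm x" by (intro mult_right_mono le) simp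
  finally show ?thesis by (cases "cadjoint A x = 0") (auto simp: power2_eq_square)
qed

section \<open>The positive square root of I - C\<close>

text \<open>The operator \<open>p(C)\<close> by Horner's scheme, which makes facts about it inductions over \<open>pCons\<close>.\<close>

definition op_poly :: "('a \<Rightarrow> 'a::real_vector) \<Rightarrow> real poly \<Rightarrow> 'a \<Rightarrow> 'a" where
  "op_poly C p = fold_coeffs (\<lambda>a P x. a *\<^sub>R x + C (P x)) p (\<lambda>_. 0)"

lemma op_poly_0 [simp]: "op_poly C 0 x = 0"
  by (simp add: op_poly_def)

lemma op_poly_pCons:
  assumes "bounded_clinear C"
  shows "op_poly C (pCons a p) x = a *\<^sub>R x + C (op_poly C p x)"
  by (cases "a = 0 \<and> p = 0") (auto simp: op_poly_def clinear_simps[OF assms])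

lemma bounded_clinear_op_poly:
  assumes C: "bounded_clinear C"
  shows "bounded_clinear (op_poly C p)"
proof (induction p)
  case 0
  show ?case by (intro bounded_clinearI[where K = 0]) simp_all
next
  case (pCons a p)
  show ?case
  proof -
    obtain K where K: "K \<ge> 0" "\<And>x. norm (C x) \<le> K * norm x"
      using bounded_clinear_bound[OF C] by blast
    obtain L where L: "\<And>x. norm (op_poly C p x) \<le> L * norm x"
      using bounded_clinear_bound[OF pCons.IH] by blast
    show ?thesis
    proof (rule bounded_clinearI)
      fix x
      have "norm (op_poly C (pCons a p) x) \<le> norm (a *\<^sub>R x) + norm (C (op_poly C p x))"
        unfolding op_poly_pCons[OF C] by (rule norm_triangle_ineq)
      also have "\<dots> \<le> \<bar>a\<bar> * norm x + K * (L * norm x)"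
        using K L[of x] by (intro add_mono order_trans[OF K(2)] mult_left_mono) auto
      finally show "norm (op_poly C (pCons a p) x) \<le> (\<bar>a\<bar> + K * L) * norm x"
        by (simp add: algebra_simps)
    qed (simp_all add: op_poly_pCons[OF C] clinear_simps[OF C] clinear_simps[OF pCons.IH]
          scaleR_scaleC scaleC_add_right scaleC_scaleC mult.commute algebra_simps)
  qed
qed

lemma op_poly_add:
  assumes C: "bounded_clinear C"
  shows "op_poly C (p + q) x = op_poly C p x + op_poly C q x"
  by (induction p q rule: poly_induct2)
    (simp_all add: op_poly_pCons[OF C] clinear_simps[OF C] algebra_simps)

lemma op_poly_smult:
  assumes C: "bounded_clinear C"
  shows "op_poly C (smult r p) x = r *\<^sub>R op_poly C p x"
  by (induction p) (simp_all add: op_poly_pCons[OF C] clinear_simps[OF C] algebra_simps)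

lemma op_poly_diff:
  assumes C: "bounded_clinear C"
  shows "op_poly C (p - q) x = op_poly C p x - op_poly C q x"
  using op_poly_add[OF C, of "p - q" q x] by simp

lemma op_poly_mult:
  assumes C: "bounded_clinear C"
  shows "op_poly C (p * q) x = op_poly C p (op_poly C q x)"
  by (induction p)
    (simp_all add: op_poly_pCons[OF C] op_poly_add[OF C] op_poly_smult[OF C])

lemma op_poly_intertwine:
  assumes C: "bounded_clinear C" and C': "bounded_clinear C'" and S: "bounded_clinear S"
    and comm: "\<And>x. S (C x) = C' (S x)"
  shows "S (op_poly C p x) = op_poly C' p (S x)"
  by (induction p)
    (simp_all add: op_poly_pCons[OF C] op_poly_pCons[OF C'] clinear_simps[OF S] comm)

lemma op_poly_selfadjoint:
  assumes C: "bounded_clinear C" and sa: "\<And>x y. cinner (C x) y = cinner x (C y)"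
  shows "cinner (op_poly C p x) y = cinner x (op_poly C p y)"
proof (induction p arbitrary: x y)
  case (pCons a p)
  have "op_poly C p (C y) = C (op_poly C p y)"
    by (rule op_poly_intertwine[OF C C C, symmetric]) simp
  then show ?case by (simp add: op_poly_pCons[OF C] cinner_simps sa pCons.IH)
qed simp

definition nonneg_coeffs :: "real poly \<Rightarrow> bool" where
  "nonneg_coeffs p \<longleftrightarrow> (\<forall>i. 0 \<le> coeff p i)"

lemma nonneg_coeffs_0 [simp]: "nonneg_coeffs 0"
  by (simp add: nonneg_coeffs_def)

lemma nonneg_coeffs_pCons [simp]: "nonneg_coeffs (pCons a p) \<longleftrightarrow> 0 \<le> a \<and> nonneg_coeffs p"
  unfolding nonneg_coeffs_def by (metis coeff_pCons_0 coeff_pCons_Suc not0_implies_Suc)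

lemma nonneg_coeffs_add: "nonneg_coeffs p \<Longrightarrow> nonneg_coeffs q \<Longrightarrow> nonneg_coeffs (p + q)"
  by (simp add: nonneg_coeffs_def)

lemma nonneg_coeffs_smult: "nonneg_coeffs p \<Longrightarrow> 0 \<le> r \<Longrightarrow> nonneg_coeffs (smult r p)"
  by (simp add: nonneg_coeffs_def)

lemma nonneg_coeffs_mult: "nonneg_coeffs p \<Longrightarrow> nonneg_coeffs q \<Longrightarrow> nonneg_coeffs (p * q)"
  by (simp add: nonneg_coeffs_def coeff_mult sum_nonneg)

text \<open>For a contraction and nonnegative coefficients the triangle inequality bounds
  \<open>\<parallel>\<Sum> a\<^sub>i C\<^sup>i\<parallel>\<close> by \<open>\<Sum> a\<^sub>i = p(1)\<close>. This turns convergence of operators into convergence of real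
  numbers.\<close>

lemma norm_op_poly_le:
  assumes C: "bounded_clinear C" and le: "\<And>x. norm (C x) \<le> norm x"
    and "nonneg_coeffs p"
  shows "norm (op_poly C p x) \<le> poly p 1 * norm x"
  using assms(3)
proof (induction p)
  case (pCons a p)
  have "norm (op_poly C (pCons a p) x) \<le> norm (a *\<^sub>R x) + norm (C (op_poly C p x))"
    unfolding op_poly_pCons[OF C] by (rule norm_triangle_ineq)
  also have "\<dots> \<le> a * norm x + poly p 1 * norm x"
    using pCons le[of "op_poly C p x"] by (intro add_mono) auto
  finally show ?case by (simp add: algebra_simps)
qed simp

text \<open>Iteration towards the solution \<open>q = 1 - sqrt(1 - X)\<close> of \<open>(1 - q)\<^sup>2 = 1 - X\<close>, written as the
  fixed-point equation \<open>q = (X + q\<^sup>2) / 2\<close>.\<close>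

fun sqrt_poly :: "nat \<Rightarrow> real poly" where
  "sqrt_poly 0 = 0"
| "sqrt_poly (Suc n) = smult (1/2) ([:0, 1:] + sqrt_poly n * sqrt_poly n)"

lemma nonneg_coeffs_sqrt_poly: "nonneg_coeffs (sqrt_poly n)"
  by (induction n) (auto intro!: nonneg_coeffs_add nonneg_coeffs_smult nonneg_coeffs_mult)

text \<open>By induction, since \<open>q\<^sub>n\<^sub>+\<^sub>2 - q\<^sub>n\<^sub>+\<^sub>1 = (q\<^sub>n\<^sub>+\<^sub>1 - q\<^sub>n) (q\<^sub>n\<^sub>+\<^sub>1 + q\<^sub>n) / 2\<close>.\<close>

lemma nonneg_coeffs_sqrt_poly_Suc_diff: "nonneg_coeffs (sqrt_poly (Suc n) - sqrt_poly n)"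
proof (induction n)
  case (Suc n)
  have "sqrt_poly (Suc (Suc n)) - sqrt_poly (Suc n) =
      smult (1/2) ((sqrt_poly (Suc n) - sqrt_poly n) * (sqrt_poly (Suc n) + sqrt_poly n))"
    unfolding sqrt_poly.simps(2)[of "Suc n"]
    by (subst (3) sqrt_poly.simps(2)) (simp add: algebra_simps smult_diff_right smult_add_right del: sqrt_poly.simps(2))
  then show ?case
    using Suc by (simp only:) (intro nonneg_coeffs_add nonneg_coeffs_smult nonneg_coeffs_mult
        nonneg_coeffs_sqrt_poly; simp)
qed simp

lemma nonneg_coeffs_sqrt_poly_diff: "n \<le> m \<Longrightarrow> nonneg_coeffs (sqrt_poly m - sqrt_poly n)"
proof (induction m rule: dec_induct)
  case (step m)
  then show ?case
    using nonneg_coeffs_add[OF nonneg_coeffs_sqrt_poly_Suc_diff[of m] step.IH]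
    by (simp del: sqrt_poly.simps)
qed simp

lemma poly_nonneg_coeffs_1: "nonneg_coeffs p \<Longrightarrow> 0 \<le> poly p 1"
  by (induction p) auto

lemma sqrt_poly_1_le: "poly (sqrt_poly n) 1 \<le> 1"
proof (induction n)
  case (Suc n)
  have "poly (sqrt_poly n) 1 * poly (sqrt_poly n) 1 \<le> 1 * 1"
    using Suc poly_nonneg_coeffs_1[OF nonneg_coeffs_sqrt_poly[of n]] by (intro mult_mono) auto
  then show ?case by simp
qed simp

definition one_minus_sqrt :: "('a \<Rightarrow> 'a::chilbert_space) \<Rightarrow> 'a \<Rightarrow> 'a" where
  "one_minus_sqrt C x = lim (\<lambda>n. op_poly C (sqrt_poly n) x)"

locale clinear_contraction =
  fixes C :: "'a::chilbert_space \<Rightarrow> 'a"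
  assumes clinear: "bounded_clinear C" and norm_le: "norm (C x) \<le> norm x"
begin

lemma norm_op_sqrt_poly_le: "norm (op_poly C (sqrt_poly n) x) \<le> norm x"
proof -
  have "norm (op_poly C (sqrt_poly n) x) \<le> poly (sqrt_poly n) 1 * norm x"
    by (rule norm_op_poly_le[OF clinear norm_le nonneg_coeffs_sqrt_poly])
  also have "\<dots> \<le> 1 * norm x" by (intro mult_right_mono sqrt_poly_1_le) simp
  finally show ?thesis by simp
qed

text \<open>The values \<open>q\<^sub>n(1)\<close> increase and are at most \<open>1\<close>, hence form a Cauchy sequence, and they
  dominate the distances between the vectors \<open>q\<^sub>n(C) x\<close>.\<close>

lemma tendsto_one_minus_sqrt: "(\<lambda>n. op_poly C (sqrt_poly n) x) \<longlonglongrightarrow> one_minus_sqrt C x"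
proof -
  let ?a = "\<lambda>n. poly (sqrt_poly n) 1"
  have dist_le: "norm (op_poly C (sqrt_poly m) x - op_poly C (sqrt_poly n) x) \<le> (?a m - ?a n) * norm x"
    if "n \<le> m" for m n
    using norm_op_poly_le[OF clinear norm_le nonneg_coeffs_sqrt_poly_diff[OF that], of x]
    by (simp add: op_poly_diff[OF clinear])
  have "incseq ?a"
    using poly_nonneg_coeffs_1[OF nonneg_coeffs_sqrt_poly_diff] by (intro monoI) fastforce
  then have "Cauchy ?a"
    using incseq_convergent[of ?a 1] sqrt_poly_1_le LIMSEQ_imp_Cauchy by blast
  have "Cauchy (\<lambda>n. op_poly C (sqrt_poly n) x)"
  proof (rule CauchyI')
    fix e :: real assume e: "e > 0"
    then have "e / (norm x + 1) > 0" by (simp add: add_nonneg_pos)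
    then obtain N where N: "\<And>m n. m \<ge> N \<Longrightarrow> n \<ge> N \<Longrightarrow> dist (?a m) (?a n) < e / (norm x + 1)"
      using \<open>Cauchy ?a\<close> unfolding Cauchy_def by blast
    have "dist (op_poly C (sqrt_poly m) x) (op_poly C (sqrt_poly n) x) < e"
      if "N \<le> m" "m < n" for m n
    proof -
      have d: "?a n - ?a m < e / (norm x + 1)" using N[of n m] that by (simp add: dist_real_def)
      have "dist (op_poly C (sqrt_poly m) x) (op_poly C (sqrt_poly n) x) \<le> (?a n - ?a m) * norm x"
        using dist_le[of m n] that by (simp add: dist_norm norm_minus_commute)
      also have "\<dots> \<le> (e / (norm x + 1)) * norm x"
        using d by (intro mult_right_mono) auto
      also have "\<dots> < e"
      proof -
        have "norm x + 1 > 0" by (simp add: add_nonneg_pos)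
        with e show ?thesis by (simp add: field_simps)
      qed
      finally show ?thesis .
    qed
    then show "\<exists>M. \<forall>m\<ge>M. \<forall>n>m. dist (op_poly C (sqrt_poly m) x) (op_poly C (sqrt_poly n) x) < e"
      by blast
  qed
  then show ?thesis
    unfolding one_minus_sqrt_def by (simp add: Cauchy_convergent convergent_LIMSEQ_iff[symmetric])
qed

lemma norm_one_minus_sqrt_le: "norm (one_minus_sqrt C x) \<le> norm x"
  by (rule Lim_norm_ubound[OF _ tendsto_one_minus_sqrt]) (auto simp: norm_op_sqrt_poly_le)

lemma bounded_clinear_one_minus_sqrt: "bounded_clinear (one_minus_sqrt C)"
proof (rule bounded_clinearI[where K = 1])
  note lin = clinear_simps[OF bounded_clinear_op_poly[OF clinear]]
  show "one_minus_sqrt C (x + y) = one_minus_sqrt C x + one_minus_sqrt C y" for x y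
    using tendsto_add[OF tendsto_one_minus_sqrt[of x] tendsto_one_minus_sqrt[of y]]
      tendsto_one_minus_sqrt[of "x + y"] by (simp add: lin LIMSEQ_unique)
  have "bounded_linear (\<lambda>x :: 'a. c *\<^sub>C x)" for c
    by (rule bounded_linear_intro[where K = "cmod c"])
      (simp_all add: scaleC_add_right scaleR_scaleC scaleC_scaleC norm_scaleC mult.commute)
  then show "one_minus_sqrt C (c *\<^sub>C x) = c *\<^sub>C one_minus_sqrt C x" for c x
    using bounded_linear.tendsto[OF _ tendsto_one_minus_sqrt[of x], of "\<lambda>x. c *\<^sub>C x"]
      tendsto_one_minus_sqrt[of "c *\<^sub>C x"] by (simp add: lin LIMSEQ_unique)
qed (simp add: norm_one_minus_sqrt_le)

text \<open>The limit of the recursion for \<open>q\<^sub>n\<close>. The square converges because the operators \<open>q\<^sub>n(C)\<close> are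
  uniformly bounded: \<open>q\<^sub>n(C) q\<^sub>n(C) x\<close> and \<open>q\<^sub>n(C) L x\<close> differ by at most \<open>\<parallel>q\<^sub>n(C) x - L x\<parallel>\<close>.\<close>

lemma one_minus_sqrt_fixpoint:
  "2 *\<^sub>R one_minus_sqrt C x = C x + one_minus_sqrt C (one_minus_sqrt C x)"
proof -
  let ?P = "\<lambda>n. op_poly C (sqrt_poly n)" and ?L = "one_minus_sqrt C"
  note lin = clinear_simps[OF bounded_clinear_op_poly[OF clinear]]
  have "(\<lambda>n. ?P n (?P n x - ?L x)) \<longlonglongrightarrow> 0"
  proof (rule Lim_null_comparison)
    show "\<forall>\<^sub>F n in sequentially. norm (?P n (?P n x - ?L x)) \<le> norm (?P n x - ?L x)"
      by (simp add: norm_op_sqrt_poly_le)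
    show "(\<lambda>n. norm (?P n x - ?L x)) \<longlonglongrightarrow> 0"
      using tendsto_one_minus_sqrt[of x] by (intro tendsto_norm_zero) (simp add: LIM_zero)
  qed
  from tendsto_add[OF this tendsto_one_minus_sqrt[of "?L x"]]
  have "(\<lambda>n. ?P n (?P n x)) \<longlonglongrightarrow> ?L (?L x)" by (simp add: lin)
  then have "(\<lambda>n. C x + ?P n (?P n x)) \<longlonglongrightarrow> C x + ?L (?L x)" by (intro tendsto_intros)
  moreover have "C x + ?P n (?P n x) = 2 *\<^sub>R ?P (Suc n) x" for n
    by (simp add: op_poly_smult[OF clinear] op_poly_add[OF clinear] op_poly_mult[OF clinear]
        op_poly_pCons[OF clinear] clinear_simps[OF clinear])
  moreover have "(\<lambda>n. 2 *\<^sub>R ?P (Suc n) x) \<longlonglongrightarrow> 2 *\<^sub>R ?L x"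
    using LIMSEQ_Suc[OF tendsto_one_minus_sqrt[of x]] by (intro tendsto_intros)
  ultimately show ?thesis by (simp only: LIMSEQ_unique)
qed

end

lemma one_minus_sqrt_intertwine:
  assumes C: "clinear_contraction C" and C': "clinear_contraction C'" and S: "bounded_clinear S"
    and comm: "\<And>x. S (C x) = C' (S x)"
  shows "S (one_minus_sqrt C x) = one_minus_sqrt C' (S x)"
proof -
  have "bounded_linear S" using S by (simp add: bounded_clinear_def)
  then have "(\<lambda>n. S (op_poly C (sqrt_poly n) x)) \<longlonglongrightarrow> S (one_minus_sqrt C x)"
    by (rule bounded_linear.tendsto[OF _ clinear_contraction.tendsto_one_minus_sqrt[OF C]])
  moreover have "S (op_poly C (sqrt_poly n) x) = op_poly C' (sqrt_poly n) (S x)" for n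
    using C C' unfolding clinear_contraction_def by (intro op_poly_intertwine S comm) auto
  ultimately show ?thesis
    using clinear_contraction.tendsto_one_minus_sqrt[OF C', of "S x"] LIMSEQ_unique by simp
qed

lemma bounded_linear_Re_cinner_left: "bounded_linear (\<lambda>x. Re (cinner x (y :: 'a::complex_inner)))"
proof (rule bounded_linear_intro[where K = "norm y"])
  show "norm (Re (cinner x y)) \<le> norm x * norm y" for x
    using Re_cinner_le_norm[of x y] Re_cinner_le_norm[of "- x" y]
    by (simp add: cinner_minus_left abs_le_iff)
qed (simp_all add: cinner_add_left cinner_scaleR_left)

lemma Re_selfadjoint_imp_selfadjoint:
  assumes A: "bounded_clinear A" and "\<And>x y. Re (cinner (A x) y) = Re (cinner x (A y))"
  shows "cinner (A x) y = cinner x (A y)"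
proof (rule complex_eqI)
  show "Im (cinner (A x) y) = Im (cinner x (A y))"
    using assms(2)[of "\<i> *\<^sub>C x" y] by (simp add: clinear_simps[OF A] cinner_scaleC_left)
qed (rule assms)

lemma one_minus_sqrt_selfadjoint:
  assumes "clinear_contraction C" and sa: "\<And>x y. cinner (C x) y = cinner x (C y)"
  shows "cinner (one_minus_sqrt C x) y = cinner x (one_minus_sqrt C y)"
proof -
  interpret clinear_contraction C by fact
  show ?thesis
  proof (rule Re_selfadjoint_imp_selfadjoint[OF bounded_clinear_one_minus_sqrt])
    fix x y
    have "(\<lambda>n. Re (cinner (op_poly C (sqrt_poly n) x) y)) \<longlonglongrightarrow> Re (cinner (one_minus_sqrt C x) y)"
      for x y
      by (rule bounded_linear.tendsto[OF bounded_linear_Re_cinner_left tendsto_one_minus_sqrt])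
    from this[of x y] this[of y x]
    show "Re (cinner (one_minus_sqrt C x) y) = Re (cinner x (one_minus_sqrt C y))"
      by (simp add: op_poly_selfadjoint[OF clinear sa] Re_cinner_commute[of x] LIMSEQ_unique)
  qed
qed

text \<open>Polarisation: as \<open>\<langle>A v, v\<rangle>\<close> is real for \<open>v = x\<close>, \<open>v = y\<close> and \<open>v = x + \<i> y\<close>, the real part of
  the form \<open>\<langle>A x, y\<rangle>\<close> is symmetric.\<close>

lemma positive_op_selfadjoint:
  assumes "positive_op A"
  shows "cinner (A x) y = cinner x (A y)"
proof -
  have A: "bounded_clinear A" and real: "Im (cinner (A x) x) = 0" for x
    using assms unfolding positive_op_def by (auto simp: complex_nonneg_Reals_iff)
  show ?thesis
  proof (rule Re_selfadjoint_imp_selfadjoint[OF A])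
    fix x y
    have "Im (cinner (A (x + \<i> *\<^sub>C y)) (x + \<i> *\<^sub>C y)) = 0" by (rule real)
    then have "Re (cinner (A y) x) = Re (cinner (A x) y)"
      by (simp add: clinear_simps[OF A] cinner_simps cinner_scaleC_left cinner_scaleC_right real)
    then show "Re (cinner (A x) y) = Re (cinner x (A y))"
      by (simp add: Re_cinner_commute[of x])
  qed
qed

text \<open>A zero of the form \<open>\<langle>A x, x\<rangle> \<ge> 0\<close> is a minimum of it, and \<open>A y\<close> is half the gradient there;
  it suffices to vary \<open>y\<close> in the direction \<open>A y\<close>.\<close>

lemma positive_op_eq_zeroI:
  assumes pos: "positive_op A" and zero: "Re (cinner (A y) y) = 0"
  shows "A y = 0"
proof -
  have A: "bounded_clinear A" and nn: "0 \<le> Re (cinner (A x) x)" for x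
    using pos unfolding positive_op_def by (auto simp: complex_nonneg_Reals_iff)
  let ?z = "A y"
  have "0 \<le> t\<^sup>2 * Re (cinner (A ?z) ?z) + 2 * t * (norm ?z)\<^sup>2" for t
  proof -
    have "cinner (A ?z) y = complex_of_real ((norm ?z)\<^sup>2)"
      by (simp add: positive_op_selfadjoint[OF pos] cinner_self)
    then show ?thesis
      using nn[of "y + t *\<^sub>R ?z"] zero
      by (simp add: clinear_simps[OF A] cinner_simps cinner_self power2_eq_square algebra_simps)
  qed
  then have "(norm ?z)\<^sup>2 = 0" by (rule linear_coeff_zero_if_quadratic_nonneg)
  then show ?thesis by simp
qed

text \<open>For uniqueness, a positive root \<open>E\<close> commutes with \<open>C = I - E\<^sup>2\<close>, hence with \<open>D\<close>, which is a limit
  of polynomials in \<open>C\<close>. So \<open>(D + E) (D - E) = D\<^sup>2 - E\<^sup>2 = 0\<close>, and for \<open>y = (D - E) x\<close> the nonnegative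
  numbers \<open>\<langle>D y, y\<rangle>\<close> and \<open>\<langle>E y, y\<rangle>\<close> add up to \<open>0\<close>. Then \<open>D y = E y = 0\<close>, and
  \<open>\<parallel>y\<parallel>\<^sup>2 = \<langle>x, (D - E) y\<rangle> = 0\<close>.\<close>

lemma op_sqrt_one_minus:
  fixes C :: "'a::chilbert_space \<Rightarrow> 'a"
  assumes "clinear_contraction C" and sa: "\<And>x y. cinner (C x) y = cinner x (C y)"
  defines "D \<equiv> \<lambda>x. x - one_minus_sqrt C x"
  shows "positive_op D" and "D (D x) = x - C x" and "op_sqrt (\<lambda>x. x - C x) = D"
proof -
  interpret clinear_contraction C by fact
  note lin = clinear_simps[OF bounded_clinear_one_minus_sqrt]
  have D: "bounded_clinear D"
  proof (rule bounded_clinearI[where K = 2])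
    show "norm (D x) \<le> 2 * norm x" for x
      using norm_triangle_ineq4[of x "one_minus_sqrt C x"] norm_one_minus_sqrt_le[of x]
      by (simp add: D_def)
    show "D (c *\<^sub>C x) = c *\<^sub>C D x" for c x
      by (simp add: D_def lin scaleC_diff_right)
  qed (simp add: D_def lin)
  show pos: "positive_op D"
    unfolding positive_op_def complex_nonneg_Reals_iff
  proof (intro conjI D allI)
    fix x
    have "Re (cinner (one_minus_sqrt C x) x) \<le> norm (one_minus_sqrt C x) * norm x"
      by (rule Re_cinner_le_norm)
    also have "\<dots> \<le> norm x * norm x" by (intro mult_right_mono norm_one_minus_sqrt_le) simp
    finally show "0 \<le> Re (cinner (D x) x)"
      by (simp add: D_def cinner_simps cinner_self power2_eq_square)
    have "Im (cinner (one_minus_sqrt C x) x) = 0"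
      using one_minus_sqrt_selfadjoint[OF assms(1,2), of x x]
        cinner_commute[of x "one_minus_sqrt C x"] by (simp add: complex_eq_iff)
    then show "Im (cinner (D x) x) = 0"
      by (simp add: D_def cinner_simps cinner_self)
  qed
  show D_sq: "D (D x) = x - C x" for x
    using one_minus_sqrt_fixpoint[of x] by (simp add: D_def lin scaleR_2 algebra_simps)
  show "op_sqrt (\<lambda>x. x - C x) = D"
    unfolding op_sqrt_def
  proof (rule the_equality)
    show "positive_op D \<and> D \<circ> D = (\<lambda>x. x - C x)" using pos D_sq by auto
  next
    fix E assume *: "positive_op E \<and> E \<circ> E = (\<lambda>x. x - C x)"
    then have E: "bounded_clinear E" and E_sq: "E (E x) = x - C x" for x
      by (auto simp: positive_op_def fun_eq_iff)
    have "E (C x) = C (E x)" for x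
    proof -
      have "E (x - C x) = E x - C (E x)" using E_sq[of x] E_sq[of "E x"] by simp
      then show ?thesis by (simp add: clinear_simps[OF E])
    qed
    then have "E (one_minus_sqrt C x) = one_minus_sqrt C (E x)" for x
      by (rule one_minus_sqrt_intertwine[OF assms(1,1) E])
    then have comm: "E (D x) = D (E x)" for x by (simp add: D_def clinear_simps[OF E])
    show "E = D"
    proof
      fix x
      define y where "y = D x - E x"
      have "D y + E y = 0"
        by (simp add: y_def clinear_simps[OF E] clinear_simps[OF D] comm D_sq E_sq)
      then have "Re (cinner (D y) y) + Re (cinner (E y) y) = 0"
        by (metis cinner_add_left cinner_zero_left plus_complex.simps(1) zero_complex.simps(1))
      moreover have "0 \<le> Re (cinner (D y) y)" "0 \<le> Re (cinner (E y) y)"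
        using pos * by (auto simp: positive_op_def complex_nonneg_Reals_iff)
      ultimately have "D y = 0" "E y = 0"
        using positive_op_eq_zeroI[OF pos] positive_op_eq_zeroI[of E] * by auto
      moreover have "cinner y y = cinner x (D y) - cinner x (E y)"
        using positive_op_selfadjoint[OF pos, of x y] positive_op_selfadjoint[of E x y] *
        by (simp add: y_def cinner_diff_left)
      ultimately have "y = 0" by (simp add: cinner_self)
      then show "E x = D x" by (simp add: y_def)
    qed
  qed
qed

section \<open>Defect operators\<close>

lemma contraction_bounded_clinear: "contraction T \<Longrightarrow> bounded_clinear T"
  by (simp add: contraction_def)

lemma contraction_norm_le:
  assumes "contraction T"
  shows "norm (T x) \<le> norm x"
proof -
  have "norm (T x) \<le> onorm T * norm x"
    using assms unfolding contraction_def bounded_clinear_def by (intro onorm) auto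
  also have "\<dots> \<le> 1 * norm x" using assms unfolding contraction_def by (intro mult_right_mono) auto
  finally show ?thesis by simp
qed

lemma contractionI: "bounded_clinear T \<Longrightarrow> (\<And>x. norm (T x) \<le> norm x) \<Longrightarrow> contraction T"
  unfolding contraction_def using onorm_bound[of 1 T] by simp

lemma contraction_cadjoint: "contraction T \<Longrightarrow> contraction (cadjoint T)"
  by (intro contractionI bounded_clinear_cadjoint norm_cadjoint_le)
    (auto intro: contraction_bounded_clinear contraction_norm_le)

lemma clinear_contraction_cadjoint_comp:
  assumes T: "contraction T"
  shows "clinear_contraction (\<lambda>x. cadjoint T (T x))"
proof
  note lin = contraction_bounded_clinear[OF T] contraction_bounded_clinear[OF contraction_cadjoint[OF T]]
  show le: "norm (cadjoint T (T x)) \<le> norm x" for x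
    using contraction_norm_le[OF T] contraction_norm_le[OF contraction_cadjoint[OF T]]
    by (rule order_trans[rotated])
  show "bounded_clinear (\<lambda>x. cadjoint T (T x))"
    by (rule bounded_clinearI[where K = 1])
      (simp_all add: clinear_simps[OF lin(1)] clinear_simps[OF lin(2)] le)
qed

lemma defect_sqrt:
  assumes T: "contraction T"
  shows "positive_op (defect T)" and "defect T (defect T x) = x - cadjoint T (T x)"
    and "defect T x = x - one_minus_sqrt (\<lambda>x. cadjoint T (T x)) x"
proof -
  have sa: "cinner (cadjoint T (T x)) y = cinner x (cadjoint T (T y))" for x y
    by (simp add: cinner_cadjoint_left cinner_cadjoint_right contraction_bounded_clinear[OF T])
  note sqrt = op_sqrt_one_minus[OF clinear_contraction_cadjoint_comp[OF T] sa]
  show "positive_op (defect T)" "defect T (defect T x) = x - cadjoint T (T x)"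
    "defect T x = x - one_minus_sqrt (\<lambda>x. cadjoint T (T x)) x"
    unfolding defect_def sqrt(3) using sqrt(1,2) by auto
qed

lemma defect_adj_eq: "contraction T \<Longrightarrow> defect_adj T = defect (cadjoint T)"
  by (simp add: defect_adj_def defect_def cadjoint_cadjoint contraction_bounded_clinear)

text \<open>Since \<open>T (T\<^sup>*T) = (TT\<^sup>*) T\<close>, the operator \<open>T\<close> intertwines \<open>T\<^sup>*T\<close> and \<open>TT\<^sup>*\<close>, and with them the
  square roots of \<open>I - T\<^sup>*T\<close> and \<open>I - TT\<^sup>*\<close>.\<close>

lemma defect_intertwine:
  assumes T: "contraction T"
  shows "T (defect T x) = defect_adj T (T x)"
proof -
  note T' = contraction_cadjoint[OF T]
  have "T (one_minus_sqrt (\<lambda>x. cadjoint T (T x)) x) =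
      one_minus_sqrt (\<lambda>x. cadjoint (cadjoint T) (cadjoint T x)) (T x)"
    by (rule one_minus_sqrt_intertwine[OF clinear_contraction_cadjoint_comp[OF T]
          clinear_contraction_cadjoint_comp[OF T'] contraction_bounded_clinear[OF T]])
      (simp add: T contraction_bounded_clinear cadjoint_cadjoint)
  then show ?thesis
    by (simp add: defect_adj_eq T T' defect_sqrt(3) clinear_simps[OF contraction_bounded_clinear[OF T]])
qed

lemma defect_adj_intertwine:
  assumes T: "contraction T"
  shows "cadjoint T (defect_adj T x) = defect T (cadjoint T x)"
  using defect_intertwine[OF contraction_cadjoint[OF T], of x]
  by (simp add: defect_adj_eq T contraction_cadjoint cadjoint_cadjoint contraction_bounded_clinear)

lemma positive_op_defect_adj: "contraction T \<Longrightarrow> positive_op (defect_adj T)"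
  and defect_adj_sq: "contraction T \<Longrightarrow> defect_adj T (defect_adj T x) = x - T (cadjoint T x)"
  by (simp_all add: defect_adj_eq defect_sqrt(1,2) contraction_cadjoint cadjoint_cadjoint
      contraction_bounded_clinear)

lemma norm_defect_sq:
  assumes T: "contraction T"
  shows "(norm (defect T x))\<^sup>2 = (norm x)\<^sup>2 - (norm (T x))\<^sup>2"
proof -
  have "(norm (defect T x))\<^sup>2 = Re (cinner (defect T (defect T x)) x)"
    using positive_op_selfadjoint[OF defect_sqrt(1)[OF T], of "defect T x" x] by (simp add: cinner_self)
  then show ?thesis
    by (simp add: defect_sqrt(2)[OF T] cinner_diff_left cinner_self
        cinner_cadjoint_left[OF contraction_bounded_clinear[OF T]])
qed

text \<open>The cross terms \<open>-2 Re \<langle>D\<^sub>T a, T\<^sup>* b\<rangle>\<close> and \<open>2 Re \<langle>T a, D\<^sub>T\<^sub>* b\<rangle>\<close> cancel, because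
  \<open>\<langle>T D\<^sub>T a, b\<rangle> = \<langle>D\<^sub>T\<^sub>* T a, b\<rangle>\<close>.\<close>

lemma julia_isometry:
  assumes T: "contraction T"
  shows "(norm (defect T a - cadjoint T b))\<^sup>2 + (norm (T a + defect_adj T b))\<^sup>2 = (norm a)\<^sup>2 + (norm b)\<^sup>2"
proof -
  have "cinner (defect T a) (cadjoint T b) = cinner (defect_adj T (T a)) b"
    by (simp add: cinner_cadjoint_right contraction_bounded_clinear T defect_intertwine)
  also have "\<dots> = cinner (T a) (defect_adj T b)"
    by (rule positive_op_selfadjoint[OF positive_op_defect_adj[OF T]])
  finally have cross: "cinner (defect T a) (cadjoint T b) = cinner (T a) (defect_adj T b)" .
  have "(norm (defect_adj T b))\<^sup>2 = (norm b)\<^sup>2 - (norm (cadjoint T b))\<^sup>2"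
    by (simp add: defect_adj_eq norm_defect_sq contraction_cadjoint T)
  then show ?thesis by (simp add: norm_diff_sq norm_add_sq norm_defect_sq T cross)
qed

text \<open>A preimage of \<open>(c, d)\<close> is its image under the adjoint of the Julia operator.\<close>

lemma julia_surjective:
  fixes c d :: "'a::chilbert_space"
  assumes T: "contraction T"
  obtains a b where "defect T a - cadjoint T b = c" and "T a + defect_adj T b = d"
proof
  let ?a = "defect T c + cadjoint T d" and ?b = "defect_adj T d - T c"
  have lin: "bounded_clinear T" "bounded_clinear (cadjoint T)" "bounded_clinear (defect T)"
    "bounded_clinear (defect_adj T)"
    using T defect_sqrt(1)[OF T] positive_op_defect_adj[OF T]
    by (auto simp: positive_op_def contraction_bounded_clinear contraction_cadjoint)
  show "defect T ?a - cadjoint T ?b = c"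
    by (simp add: clinear_simps[OF lin(2)] clinear_simps[OF lin(3)] defect_sqrt(2)[OF T]
        defect_adj_intertwine[OF T])
  show "T ?a + defect_adj T ?b = d"
    by (simp add: clinear_simps[OF lin(1)] clinear_simps[OF lin(4)] defect_adj_sq[OF T]
        defect_intertwine[OF T])
qed

section \<open>Unitary operators\<close>

lemma unitary_bounded_clinear: "unitary U \<Longrightarrow> bounded_clinear U"
  by (simp add: unitary_def)

lemma unitary_norm:
  assumes "unitary U" shows "norm (U x) = norm x"
proof -
  have "(norm (U x))\<^sup>2 = Re (cinner x (cadjoint U (U x)))"
    by (simp add: cinner_cadjoint_right unitary_bounded_clinear assms cinner_self)
  also have "cadjoint U (U x) = x" using assms by (simp add: unitary_def fun_eq_iff)
  finally show ?thesis by (simp add: cinner_self)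
qed

lemma unitary_surj: "unitary U \<Longrightarrow> surj U"
  by (metis unitary_def comp_apply id_apply surj_def)

text \<open>An isometry preserves the real part of the inner product by polarisation, so the adjoint is a left
  inverse; surjectivity makes it a right inverse as well.\<close>

lemma unitary_if_surj_isometry:
  fixes U :: "'a::chilbert_space \<Rightarrow> 'a"
  assumes add: "\<And>x y. U (x + y) = U x + U y" and scale: "\<And>c x. U (c *\<^sub>C x) = c *\<^sub>C U x"
    and iso: "\<And>x. norm (U x) = norm x" and surj: "surj U"
  shows "unitary U"
proof -
  have U: "bounded_clinear U"
    by (rule bounded_clinearI[where K = 1]) (simp_all add: add scale iso)
  have "cadjoint U (U x) = x" for x
  proof (rule Re_cinner_eqI)
    fix v
    have "Re (cinner (U v) (U x)) = Re (cinner v x)"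
      using norm_add_sq[of "U v" "U x"] norm_add_sq[of v x] by (simp add: iso flip: add)
    then show "Re (cinner v (cadjoint U (U x))) = Re (cinner v x)"
      by (simp add: cinner_cadjoint_right U)
  qed
  then have "cadjoint U \<circ> U = id" "U \<circ> cadjoint U = id"
    using surj by (auto simp: fun_eq_iff) (metis surjD)
  with U show ?thesis by (simp add: unitary_def)
qed

section \<open>The dilation\<close>

text \<open>Two candidates for the projection of \<open>x\<close> differ by a vector of \<open>M\<close> that is orthogonal to \<open>M\<close>,
  hence to itself.\<close>

lemma orth_proj_eqI:
  assumes "y \<in> M" "\<And>z. z \<in> M \<Longrightarrow> cinner (x - y) z = 0"
    and diff: "\<And>u v. u \<in> M \<Longrightarrow> v \<in> M \<Longrightarrow> u - v \<in> M"
  shows "orth_proj M x = y"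
  unfolding orth_proj_def
proof (rule the_equality)
  fix y' assume y': "y' \<in> M \<and> (\<forall>z\<in>M. cinner (x - y') z = 0)"
  then have "cinner (x - y) (y' - y) = 0" "cinner (x - y') (y' - y) = 0"
    using assms by auto
  moreover have "y' - y = (x - y) - (x - y')" by simp
  ultimately have "cinner (y' - y) (y' - y) = 0"
    by (metis cinner_diff_left diff_self)
  then show "y' = y" by (simp add: cinner_self)
qed (use assms in blast)

lemma cinner_zeroth_right: "cinner k (zeroth h) = cinner (coord k 0) h"
proof -
  have "cinner k (zeroth h) = (\<Sum>\<^sub>\<infinity>i. cinner (coord k i) (if i = 0 then h else 0))"
    by (simp add: cinner_zsum_def zeroth.rep_eq)
  also have "\<dots> = (\<Sum>\<^sub>\<infinity>i\<in>{0}. cinner (coord k i) (if i = 0 then h else 0))"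
    by (rule infsum_cong_neutral) auto
  finally show ?thesis by simp
qed

lemma zeroth_add: "zeroth (x + y) = zeroth x + zeroth y"
  by (rule zsum_eqI) (simp add: zeroth.rep_eq plus_zsum.rep_eq)

lemma zeroth_diff: "zeroth (x - y) = zeroth x - zeroth y"
  by (rule zsum_eqI) (simp add: zeroth.rep_eq coord_minus)

lemma zeroth_scaleC: "zeroth (c *\<^sub>C x) = c *\<^sub>C zeroth x"
  by (rule zsum_eqI) (simp add: zeroth.rep_eq scaleC_zsum.rep_eq)

lemma isometric_embedding_zeroth: "isometric_embedding (zeroth :: 'a::chilbert_space \<Rightarrow> 'a zsum)"
proof -
  have norm: "norm (zeroth x) = norm x" for x :: 'a
  proof -
    have "complex_of_real ((norm (zeroth x))\<^sup>2) = complex_of_real ((norm x)\<^sup>2)"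
      unfolding cinner_self[symmetric] by (simp add: cinner_zeroth_right) (simp add: zeroth.rep_eq)
    then have "(norm (zeroth x))\<^sup>2 = (norm x)\<^sup>2" using of_real_eq_iff by blast
    then show ?thesis by (simp add: power2_eq_iff_nonneg)
  qed
  then show ?thesis
    unfolding isometric_embedding_def
    by (auto intro: bounded_clinearI[where K = 1] simp: zeroth_add zeroth_scaleC)
qed

lemma orth_proj_range_zeroth: "orth_proj (range zeroth) k = zeroth (coord k 0)"
proof (rule orth_proj_eqI)
  show "cinner (k - zeroth (coord k 0)) z = 0" if "z \<in> range zeroth" for z
    using that by (auto simp: cinner_zeroth_right coord_minus zeroth.rep_eq)
qed (auto simp flip: zeroth_diff)

text \<open>Here \<open>g\<close> is obtained from \<open>h\<close> by the shift by one place, except that the two entries at \<open>0\<close>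
  and \<open>1\<close> may be mixed isometrically. The equivalence of square summability shows both that the
  operator maps into the direct sum and that preimages lie in it.\<close>

lemma shifted_square_sum:
  fixes g h :: "int \<Rightarrow> 'a::real_normed_vector"
  assumes off: "\<And>i. i \<notin> {-1, 0} \<Longrightarrow> norm (g i) = norm (h (i + 1))"
    and block: "(norm (g (-1)))\<^sup>2 + (norm (g 0))\<^sup>2 = (norm (h 0))\<^sup>2 + (norm (h 1))\<^sup>2"
  shows "sqsum g \<longleftrightarrow> sqsum h"
    and "sqsum h \<Longrightarrow> (\<Sum>\<^sub>\<infinity>i. (norm (g i))\<^sup>2) = (\<Sum>\<^sub>\<infinity>i. (norm (h i))\<^sup>2)"
proof -
  let ?s = "\<lambda>i. (norm (h (i + 1)))\<^sup>2" and ?g = "\<lambda>i. (norm (g i))\<^sup>2"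
  let ?B = "{-1, 0} :: int set"
  have bij: "bij (\<lambda>i::int. i + 1)" by (rule bij_plus_right)
  have shift: "(?s has_sum S) UNIV \<longleftrightarrow> ((\<lambda>i. (norm (h i))\<^sup>2) has_sum S) UNIV" for S
    using has_sum_reindex_bij_betw[OF bij, of "\<lambda>i. (norm (h i))\<^sup>2" S] by simp
  \<comment> \<open>Removing the two terms at \<open>-1\<close> and \<open>0\<close>, where \<open>g\<close> and the shift of \<open>h\<close> agree only in total.\<close>
  have split: "(f has_sum S) UNIV \<longleftrightarrow> (f has_sum (S - (f (-1) + f 0))) (- ?B)"
    for f :: "int \<Rightarrow> real" and S
  proof
    assume "(f has_sum S) UNIV"
    from has_sum_Diff[OF this has_sum_finite[of ?B f]]
    show "(f has_sum (S - (f (-1) + f 0))) (- ?B)" by (simp add: Compl_eq_Diff_UNIV)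
  next
    assume "(f has_sum (S - (f (-1) + f 0))) (- ?B)"
    from has_sum_Un_disjoint[OF this has_sum_finite[of ?B f]]
    show "(f has_sum S) UNIV" by (simp del: Un_insert_right add: Compl_partition2)
  qed
  have "(?g has_sum T) (- ?B) \<longleftrightarrow> (?s has_sum T) (- ?B)" for T
    by (rule has_sum_cong) (use off in auto)
  then have main: "(?g has_sum S) UNIV \<longleftrightarrow> ((\<lambda>i. (norm (h i))\<^sup>2) has_sum S) UNIV" for S
    unfolding shift[symmetric] split[of ?g] split[of ?s] using block by simp
  then show "sqsum g \<longleftrightarrow> sqsum h" by (simp add: sqsum_def summable_on_def)
  assume "sqsum h"
  then have "((\<lambda>i. (norm (h i))\<^sup>2) has_sum (\<Sum>\<^sub>\<infinity>i. (norm (h i))\<^sup>2)) UNIV"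
    unfolding sqsum_def by (rule has_sum_infsum)
  then show "(\<Sum>\<^sub>\<infinity>i. (norm (g i))\<^sup>2) = (\<Sum>\<^sub>\<infinity>i. (norm (h i))\<^sup>2)"
    unfolding main[symmetric] by (rule infsumI)
qed

locale UT_data =
  fixes T U1 U2 :: "'a::chilbert_space \<Rightarrow> 'a" and Y X :: "int \<Rightarrow> 'a \<Rightarrow> 'a"
  assumes T: "contraction T" and U1: "unitary U1" and U2: "unitary U2"
    and Y: "i \<le> -1 \<Longrightarrow> unitary (Y i)" and X: "i \<ge> 1 \<Longrightarrow> unitary (X i)"
begin

abbreviation "U_coord \<equiv> UT_coord T U1 U2 Y X"
abbreviation "U \<equiv> UT T U1 U2 Y X"

lemma U_coord_norm_off:
  assumes "i \<notin> {-1, 0}"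
  shows "norm (U_coord h i) = norm (h (i + 1))"
  using assms unitary_norm[OF Y[of "i + 1"]] unitary_norm[OF X[of i]]
  by (auto simp: UT_coord_def)

lemma U_coord_norm_block:
  "(norm (U_coord h (-1)))\<^sup>2 + (norm (U_coord h 0))\<^sup>2 = (norm (h 0))\<^sup>2 + (norm (h 1))\<^sup>2"
proof -
  have "U_coord h (-1) = U2 (defect T (h 0) - cadjoint T (U1 (h 1)))"
    by (simp add: UT_coord_def clinear_simps[OF unitary_bounded_clinear[OF U2]])
  then show ?thesis
    using julia_isometry[OF T, of "h 0" "U1 (h 1)"]
    by (simp add: UT_coord_def unitary_norm[OF U1] unitary_norm[OF U2])
qed

lemma U_coord_square_sum:
  shows "sqsum (U_coord h) \<longleftrightarrow> sqsum h"
    and "sqsum h \<Longrightarrow> (\<Sum>\<^sub>\<infinity>i. (norm (U_coord h i))\<^sup>2) = (\<Sum>\<^sub>\<infinity>i. (norm (h i))\<^sup>2)"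
  using U_coord_norm_off U_coord_norm_block by (intro shifted_square_sum; blast)+

lemma coord_U: "coord (U k) = U_coord (coord k)"
  unfolding UT_def using U_coord_square_sum(1) sqsum_coord[of k] by (simp add: Abs_zsum_inverse)

lemma norm_U: "norm (U k) = norm k"
  unfolding norm_zsum_def coord_U using U_coord_square_sum(2)[OF sqsum_coord] by simp

lemma bounded_clinear_entries:
  "bounded_clinear T" "bounded_clinear (cadjoint T)" "bounded_clinear (defect T)"
  "bounded_clinear (defect_adj T)" "bounded_clinear U1" "bounded_clinear U2"
  using T defect_sqrt(1)[OF T] positive_op_defect_adj[OF T] U1 U2
  by (auto simp: positive_op_def contraction_bounded_clinear contraction_cadjoint unitary_bounded_clinear)

lemma U_add: "U (k + l) = U k + U l"
proof (rule zsum_eqI)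
  fix i
  show "coord (U (k + l)) i = coord (U k + U l) i"
    using bounded_clinear_add[OF unitary_bounded_clinear[OF Y[of "i + 1"]]]
      bounded_clinear_add[OF unitary_bounded_clinear[OF X[of i]]]
    by (simp add: coord_U plus_zsum.rep_eq UT_coord_def bounded_clinear_entries[THEN bounded_clinear_add])
qed

lemma U_scaleC: "U (c *\<^sub>C k) = c *\<^sub>C U k"
proof (rule zsum_eqI)
  fix i
  show "coord (U (c *\<^sub>C k)) i = coord (c *\<^sub>C U k) i"
    using bounded_clinear_scaleC[OF unitary_bounded_clinear[OF Y[of "i + 1"]]]
      bounded_clinear_scaleC[OF unitary_bounded_clinear[OF X[of i]]]
    by (simp add: coord_U scaleC_zsum.rep_eq UT_coord_def scaleC_add_right scaleC_diff_right
        bounded_clinear_entries[THEN bounded_clinear_scaleC])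
qed

lemma U_coord_surj: "\<exists>h. U_coord h = g"
proof -
  obtain w where w: "U2 w = g (-1)" using unitary_surj[OF U2] by (metis surjD)
  obtain a b where ab: "defect T a - cadjoint T b = w" "T a + defect_adj T b = g 0"
    by (rule julia_surjective[OF T])
  obtain b' where b': "U1 b' = b" using unitary_surj[OF U1] by (metis surjD)
  define h where "h i = (if i \<le> -1 then inv (Y i) (g (i - 1)) else if i = 0 then a
    else if i = 1 then b' else inv (X (i - 1)) (g (i - 1)))" for i
  have "U_coord h i = g i" for i
  proof -
    consider "i \<le> -2" | "i = -1" | "i = 0" | "i \<ge> 1" by linarith
    then show ?thesis
    proof cases
      case 1
      then show ?thesis using surj_f_inv_f[OF unitary_surj[OF Y[of "i + 1"]]]
        by (simp add: UT_coord_def h_def)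
    next
      case 2
      have "U2 (defect T a) - U2 (cadjoint T b) = g (-1)"
        by (metis ab(1) w bounded_clinear_diff[OF bounded_clinear_entries(6)])
      with 2 show ?thesis by (simp add: UT_coord_def h_def b')
    next
      case 3
      then show ?thesis using ab(2) by (simp add: UT_coord_def h_def b')
    next
      case 4
      then show ?thesis using surj_f_inv_f[OF unitary_surj[OF X[of i]]]
        by (simp add: UT_coord_def h_def)
    qed
  qed
  then show ?thesis by blast
qed

lemma surj_U: "surj U"
unfolding surj_def
proof
  fix l
  obtain h where h: "U_coord h = coord l" using U_coord_surj by blast
  then have "sqsum h" using U_coord_square_sum(1)[of h] sqsum_coord[of l] by simp
  then have "coord (Abs_zsum h) = h" by (simp add: Abs_zsum_inverse)
  then have "U (Abs_zsum h) = l" by (intro zsum_eqI) (simp add: coord_U h)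
  then show "\<exists>k. l = U k" by blast
qed

lemma unitary_U: "unitary U"
  by (rule unitary_if_surj_isometry[OF U_add U_scaleC norm_U surj_U])

text \<open>Only the entries at \<open>0\<close> and \<open>1\<close> contribute to the new entry at \<open>0\<close>, and only entries of positive
  index contribute to the new entries of positive index. Hence the vanishing of the latter is
  carried through the induction.\<close>

lemma coord_U_power_zeroth:
  "coord ((U ^^ n) (zeroth h)) 0 = (T ^^ n) h \<and> (\<forall>i\<ge>1. coord ((U ^^ n) (zeroth h)) i = 0)"
proof (induction n)
  case 0
  show ?case by (simp add: zeroth.rep_eq)
next
  case (Suc n)
  have "X i 0 = 0" if "i \<ge> 1" for i
    by (rule bounded_clinear_zero[OF unitary_bounded_clinear[OF X[OF that]]])
  with Suc show ?case
    by (simp add: coord_U UT_coord_def bounded_clinear_entries[THEN bounded_clinear_zero])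
qed

lemma unitary_dilation_U: "unitary_dilation zeroth U T"
  unfolding unitary_dilation_def
  by (simp add: isometric_embedding_zeroth unitary_U contraction_bounded_clinear T
      orth_proj_range_zeroth coord_U_power_zeroth)

end

theorem theorem6p1:
  fixes T U1 U2 :: "'a::chilbert_space \<Rightarrow> 'a"
    and Y X :: "int \<Rightarrow> 'a \<Rightarrow> 'a"
  assumes "contraction T"
    and "unitary U1" and "unitary U2"
    and "\<And>n::nat. n \<ge> 1 \<Longrightarrow> unitary (Y (- int n))"
    and "\<And>n::nat. n \<ge> 1 \<Longrightarrow> unitary (X (int n))"
  shows "unitary_dilation zeroth (UT T U1 U2 Y X) T"
proof -
  have "unitary (Y i)" if "i \<le> -1" for i using assms(4)[of "nat (- i)"] that by simp
  moreover have "unitary (X i)" if "i \<ge> 1" for i using assms(5)[of "nat i"] that by simp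
  ultimately interpret UT_data T U1 U2 Y X using assms(1-3) by unfold_locales
  show ?thesis by (rule unitary_dilation_U)
qed

end
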